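(* Let $\gamma\in\{1,-1\}$, and let $a_n>0$, $b_n\in\mathbb R$ satisfy, as $n\to\infty$, $$a_n=n(1+\alpha n^{-1}+O(n^{-2})),\qquad b_n=2\gamma n(1+\beta n^{-1}+O(n^{-2})),$$ with $\alpha,\beta\in\mathbb R$; put $\tau=2\beta-2\alpha+1$. Set $\rho=1/4$, $$\theta_n(z)=\sqrt{z-\tau}\;n^{-1/2}\quad(n\ge1),\qquad \varphi_n(z)=\sum_{m=1}^n\theta_m(z).$$ Then for every $z\ne\gamma\tau$ in the complex plane cut along the half-axis $\gamma[\tau,\infty)$ (both edges of the cut included) the equation $$a_{n-1}F_{n-1}+b_nF_n+a_nF_{n+1}=zF_n,\qquad n\ge1,$$ has a solution $f_n(z)$ such that $$f_n(z)=(-\gamma)^n n^{-\rho}e^{i\varphi_n(\gamma z)}(1+o(1)),\qquad n\to\infty.$$ For all $n\in\mathbb Z_+$ the functions $f_n(z)$ are analytic in $z\in\mathbb C\setminus\gamma[\tau,\infty)$ and continuous up to the cut along $\gamma[\tau,\infty)$, with a possible exception of the boundary point $\gamma\tau$.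
   Context: $\mathbb Z_+=\{0,1,2,\dots\}$; $\gamma[\tau,\infty)=\{\gamma x:x\ge\tau\}$. The function $\sqrt t$ is the analytic branch on $\mathbb C\setminus[0,\infty)$ with $\Im\sqrt t>0$, and $\sqrt{t\pm i0}=\pm|t|^{1/2}$ for $t>0$ on the edges of the cut. Functions of $z$ at edge points $\lambda\pm i0$ are understood as limits from the upper/lower half-plane; multiplication by $\gamma=-1$ maps $\lambda\pm i0$ to $(-\lambda)\mp i0$. *)

theory Defs
  imports "HOL-Analysis.Analysis" "HOL-Library.Landau_Symbols"
begin

text \<open>
  Points of a complex plane cut along a real half-axis, with both edges of the cut included:
  \<open>Off z\<close> is a point off the cut, \<open>Upper x\<close> and \<open>Lower x\<close> are the edge points $x + i0$ and $x - i0$.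
\<close>

datatype cut_point = Off complex | Upper real | Lower real

fun point_value :: "cut_point \<Rightarrow> complex" where
  "point_value (Off z) = z"
| "point_value (Upper x) = complex_of_real x"
| "point_value (Lower x) = complex_of_real x"

fun shift_point :: "real \<Rightarrow> cut_point \<Rightarrow> cut_point" where
  "shift_point t (Off z) = Off (z - complex_of_real t)"
| "shift_point t (Upper x) = Upper (x - t)"
| "shift_point t (Lower x) = Lower (x - t)"

text \<open>Multiplication by a negative number interchanges the two half-planes, hence the two edges.\<close>

fun scale_point :: "real \<Rightarrow> cut_point \<Rightarrow> cut_point" where
  "scale_point g (Off z) = Off (complex_of_real g * z)"
| "scale_point g (Upper x) = (if g > 0 then Upper (g * x) else Lower (g * x))"
| "scale_point g (Lower x) = (if g > 0 then Lower (g * x) else Upper (g * x))"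

definition cut :: "real \<Rightarrow> real \<Rightarrow> real set" where
  "cut \<gamma> \<tau> = (\<lambda>x. \<gamma> * x) ` {\<tau>..}"

definition cut_plane :: "real \<Rightarrow> real \<Rightarrow> complex set" where
  "cut_plane \<gamma> \<tau> = - complex_of_real ` cut \<gamma> \<tau>"

text \<open>The cut plane together with both edges of the cut, without the end point \<open>\<gamma> * \<tau>\<close>.\<close>

definition closed_cut_plane :: "real \<Rightarrow> real \<Rightarrow> cut_point set" where
  "closed_cut_plane \<gamma> \<tau> =
     Off ` cut_plane \<gamma> \<tau> \<union> Upper ` (cut \<gamma> \<tau> - {\<gamma> * \<tau>}) \<union> Lower ` (cut \<gamma> \<tau> - {\<gamma> * \<tau>})"

text \<open>
  A complex number seen from the closed upper (lower) half-plane: a number on the cut is read as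
  the point of the upper (lower) edge.
\<close>

definition from_above :: "real \<Rightarrow> real \<Rightarrow> complex \<Rightarrow> cut_point" where
  "from_above \<gamma> \<tau> z = (if z \<in> cut_plane \<gamma> \<tau> then Off z else Upper (Re z))"

definition from_below :: "real \<Rightarrow> real \<Rightarrow> complex \<Rightarrow> cut_point" where
  "from_below \<gamma> \<tau> z = (if z \<in> cut_plane \<gamma> \<tau> then Off z else Lower (Re z))"

definition continuous_up_to_cut :: "real \<Rightarrow> real \<Rightarrow> (cut_point \<Rightarrow> complex) \<Rightarrow> bool" where
  "continuous_up_to_cut \<gamma> \<tau> g \<longleftrightarrow>
     continuous_on ({z. Im z \<ge> 0} - {complex_of_real (\<gamma> * \<tau>)}) (\<lambda>z. g (from_above \<gamma> \<tau> z)) \<and>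
     continuous_on ({z. Im z \<le> 0} - {complex_of_real (\<gamma> * \<tau>)}) (\<lambda>z. g (from_below \<gamma> \<tau> z))"

text \<open>
  The branch of the square root on the plane cut along $[0,\infty)$ with positive imaginary part,
  and its values on the edges of the cut. It is only meaningful for \<open>Off z\<close> with \<open>z\<close> not in
  $[0,\infty)$, and for edge points over $(0,\infty)$.
\<close>

fun sqrt_cut :: "cut_point \<Rightarrow> complex" where
  "sqrt_cut (Off z) = (THE w. w\<^sup>2 = z \<and> Im w > 0)"
| "sqrt_cut (Upper t) = complex_of_real (sqrt \<bar>t\<bar>)"
| "sqrt_cut (Lower t) = - complex_of_real (sqrt \<bar>t\<bar>)"

lemma sqrt_cut_Off:
  assumes "z \<notin> complex_of_real ` {0..}"
  shows "sqrt_cut (Off z) = \<i> * csqrt (- z)"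
proof -
  have sq: "(\<i> * csqrt (- z))\<^sup>2 = z"
    by (simp add: power_mult_distrib)
  have "Re (csqrt (- z)) \<noteq> 0"
  proof
    assume "Re (csqrt (- z)) = 0"
    then have "csqrt (- z) = \<i> * complex_of_real (Im (csqrt (- z)))"
      by (simp add: complex_eq_iff)
    then have "- z = (\<i> * complex_of_real (Im (csqrt (- z))))\<^sup>2"
      by (metis power2_csqrt)
    then have "z = complex_of_real ((Im (csqrt (- z)))\<^sup>2)"
      by (simp add: power_mult_distrib)
    with assms show False by (metis imageI atLeast_iff zero_le_power2)
  qed
  then have pos: "Im (\<i> * csqrt (- z)) > 0"
    using Re_csqrt[of "- z"] by simp
  have "w = \<i> * csqrt (- z)" if "w\<^sup>2 = z" "Im w > 0" for w
    using that sq pos by (metis power2_eq_iff uminus_complex.simps(2) neg_0_less_iff_less order_less_asym)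
  then show ?thesis
    unfolding sqrt_cut.simps using sq pos by (intro the_equality) blast+
qed

definition theta :: "real \<Rightarrow> nat \<Rightarrow> cut_point \<Rightarrow> complex" where
  "theta \<tau> n z = sqrt_cut (shift_point \<tau> z) * complex_of_real (real n powr (- (1 / 2)))"

definition phi :: "real \<Rightarrow> nat \<Rightarrow> cut_point \<Rightarrow> complex" where
  "phi \<tau> n z = (\<Sum>m = 1..n. theta \<tau> m z)"

end

theory Submission
  imports Defs "HOL-Complex_Analysis.Complex_Analysis" "HOL-Real_Asymp.Real_Asymp"
begin

text \<open>
  Substituting $F_n = (-\gamma)^n G_n$ and $w = \sqrt{\gamma z - \tau}$, the recurrence becomes
  \[ a_n G_{n+1} + a_{n-1} G_{n-1} = (c_n - \tau - w^2) G_n, \qquad c_n = \gamma b_n , \]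
  and because $a_n + a_{n-1} - c_n + \tau = O(1/n)$ this is a discrete form of the Bessel type
  equation $(x u')' = - w^2 u$, whose solutions behave like $x^{-1/4} e^{\pm 2 i w \sqrt x}$.
  All the dependence on $z$ is through $w$, which ranges over the closed upper half-plane without
  the origin; the two edges of the cut are the two halves of the real $w$-axis. So the cut
  disappears: what is needed is a solution that is continuous in $w$ on this set and holomorphic
  in its interior, and then $w$ has to be studied as a function of $z$ up to the edges.

  The ansatz $A_n = n^{-1/4} e^{i w S_n}$, $S_n = \sum_{m \le n} m^{-1/2}$, solves the equation up to
  a relative residual $R_n = O(1/n)$ (\<open>residual_bound\<close>); the value of $\tau$ removes the terms of order $1$
  and the exponent $1/4$ those of order $n^{-1/2}$. Writing
  $G_n = A_n u_n$ and summing twice, the normalisation $u_\infty = 1$ turns the equation into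
  \[ u_n = 1 - \sum_{m > n} \Big( \sum_{k=n}^{m-1} \frac{1}{a_k A_k A_{k+1}} \Big) A_m^2 R_m u_m . \]
  The inner sum oscillates or grows like $A_m^{-2} m^{-1/2}$: up to a summable error it telescopes
  to a multiple of $e^{-2iwS_m} - e^{-2iwS_n}$. This costs no more than a factor $1/|w|$
  (\<open>green_bound\<close>), so the Volterra kernel is $O(m^{-3/2})$, locally uniformly in $w \ne 0$.

  The Volterra equation is solved through truncations: the exact solution with $G_N = A_N$
  and $G_{N+1} = A_{N+1}$ is computed by backward recursion and is an entire function of $w$.
  It satisfies the same equation with the sum stopped at $N$, and smallness of the tail of the
  kernel makes these functions locally uniformly Cauchy in $N$ (\<open>truncated_estimates\<close>,
  \<open>truncated_uniformly_Cauchy\<close>). Their limit \<open>jost\<close> inherits the recurrence, the asymptotics,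
  continuity and holomorphy.
\<close>

section \<open>Elementary estimates\<close>

text \<open>
  Absorbing the finitely many exceptional indices into the constant lets all later estimates hold
  for every $n \ge 1$, uniformly in the spectral parameter, without a threshold to carry along.
\<close>

lemma bigo_imp_bound_from_1:
  fixes f g :: "nat \<Rightarrow> real"
  assumes "f \<in> O(g)" and "\<And>n. n \<ge> 1 \<Longrightarrow> g n > 0"
  obtains C where "C \<ge> 0" "\<And>n. n \<ge> 1 \<Longrightarrow> \<bar>f n\<bar> \<le> C * g n"
proof -
  from assms(1) obtain c where c: "eventually (\<lambda>n. norm (f n) \<le> c * norm (g n)) at_top"
    by (elim landau_o.bigE)
  then obtain N where N: "\<And>n. n \<ge> N \<Longrightarrow> \<bar>f n\<bar> \<le> c * \<bar>g n\<bar>"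
    by (auto simp: eventually_at_top_linorder)
  define C where "C = \<bar>c\<bar> + (\<Sum>n<N. \<bar>f n\<bar> / \<bar>g n\<bar>)"
  have "\<bar>f n\<bar> \<le> C * g n" if n: "n \<ge> 1" for n
  proof (cases "n < N")
    case True
    have "\<bar>f n\<bar> / \<bar>g n\<bar> \<le> (\<Sum>n<N. \<bar>f n\<bar> / \<bar>g n\<bar>)"
      using True by (intro member_le_sum) auto
    then have "\<bar>f n\<bar> / \<bar>g n\<bar> \<le> C"
      unfolding C_def by linarith
    then show ?thesis
      using assms(2)[OF n] by (simp add: field_simps)
  next
    case False
    have "c \<le> C"
      unfolding C_def using sum_nonneg[of "{..<N}" "\<lambda>n. \<bar>f n\<bar> / \<bar>g n\<bar>"] by auto
    then have "c * g n \<le> C * g n"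
      using assms(2)[OF n] by (intro mult_right_mono) auto
    moreover have "\<bar>f n\<bar> \<le> c * g n"
      using N[of n] False assms(2)[OF n] by simp
    ultimately show ?thesis
      by linarith
  qed
  moreover have "C \<ge> 0"
    unfolding C_def by (intro add_nonneg_nonneg sum_nonneg) auto
  ultimately show ?thesis
    using that by blast
qed


lemma norm_exp_minus_Taylor_le:
  fixes z :: complex
  assumes "norm z \<le> L"
  shows "norm (exp z - (\<Sum>k\<le>n. z ^ k / fact k)) \<le> exp L * norm z ^ Suc n"
proof -
  have "norm (exp z - (\<Sum>k\<le>n. z ^ k / fact k)) \<le> exp \<bar>Re z\<bar> * norm z ^ Suc n / fact n"
    by (rule Taylor_exp)
  also have "\<dots> \<le> exp \<bar>Re z\<bar> * norm z ^ Suc n"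
  proof -
    have "exp \<bar>Re z\<bar> * norm z ^ Suc n * 1 \<le> exp \<bar>Re z\<bar> * norm z ^ Suc n * fact n"
      by (intro mult_left_mono) auto
    then show ?thesis
      by (simp add: field_simps)
  qed
  also have "\<dots> \<le> exp L * norm z ^ Suc n"
    using abs_Re_le_cmod[of z] assms by (intro mult_right_mono) auto
  finally show ?thesis .
qed

text \<open>
  A discrete Gronwall inequality, run from $N$ downwards. Since the weights sum to at most $1/2$,
  the bound $2C$ for all larger indices reproduces itself: $C + \frac12 \cdot 2C = 2C$.
\<close>

lemma volterra_bound:
  fixes u q :: "nat \<Rightarrow> real"
  assumes q: "\<And>m. q m \<ge> 0" "(\<Sum>m\<in>{n0<..N}. q m) \<le> 1 / 2"
    and C: "C \<ge> 0"
    and ineq: "\<And>n. n0 \<le> n \<Longrightarrow> n \<le> N \<Longrightarrow> u n \<le> C + (\<Sum>m\<in>{n<..N}. q m * u m)"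
    and n: "n0 \<le> n" "n \<le> N"
  shows "u n \<le> 2 * C"
  using n
proof (induction "N - n" arbitrary: n rule: less_induct)
  case less
  have "(\<Sum>m\<in>{n<..N}. q m * u m) \<le> (\<Sum>m\<in>{n<..N}. q m * (2 * C))"
    using less q(1) by (intro sum_mono mult_left_mono less.hyps) auto
  also have "\<dots> = (\<Sum>m\<in>{n<..N}. q m) * (2 * C)"
    by (simp add: sum_distrib_right)
  also have "\<dots> \<le> (\<Sum>m\<in>{n0<..N}. q m) * (2 * C)"
    using less.prems q(1) C by (intro mult_right_mono sum_mono2) auto
  also have "\<dots> \<le> 1 / 2 * (2 * C)"
    using q(2) C by (intro mult_right_mono) auto
  finally show ?case
    using ineq[OF less.prems] by simp
qed


section \<open>Asymptotics of the coefficients\<close>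

text \<open>
  The coefficients after the substitution that removes the factor $(-\gamma)^n$; the same recurrence
  serves both signs of $\gamma$. The name refers to the limiting equation $(x u')' = -w^2 u$, which
  is solved by Bessel functions of order zero in $2 w \sqrt x$.
\<close>

locale discrete_bessel =
  fixes a c :: "nat \<Rightarrow> real" and \<alpha> \<beta> \<tau> :: real
  assumes a_pos: "\<And>n. a n > 0"
    and a_asymp: "(\<lambda>n. a n - (real n + \<alpha>)) \<in> O(\<lambda>n. 1 / real n)"
    and c_asymp: "(\<lambda>n. c n - (2 * real n + 2 * \<beta>)) \<in> O(\<lambda>n. 1 / real n)"
    and tau_eq: "\<tau> = 2 * \<beta> - 2 * \<alpha> + 1"
begin

text \<open>
  The real factors of the two exponentials $e^{iw/\sqrt{n+1}}$ and $e^{-iw/\sqrt n}$ that remain when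
  the ansatz is put into the recurrence and divided by its value at $n$. Separating them from the
  exponentials makes all asymptotic expansions real and independent of $w$.
\<close>

definition fwd :: "nat \<Rightarrow> real" where
  "fwd n = a n * (real (n + 1) powr (- 1/4) / real n powr (- 1/4))"

definition bwd :: "nat \<Rightarrow> real" where
  "bwd n = a (n - 1) * (real (n - 1) powr (- 1/4) / real n powr (- 1/4))"

abbreviation h :: "nat \<Rightarrow> real" where "h n \<equiv> real n powr (- (1 / 2))"

lemma fwd_asymp: "(\<lambda>n. fwd n - (real n + \<alpha> - 1/4)) \<in> O(\<lambda>n. 1 / real n)"
proof -
  have 1: "(\<lambda>n. (a n - (real n + \<alpha>)) * (real (n + 1) powr (- 1/4) / real n powr (- 1/4)))
      \<in> O(\<lambda>n. 1 / real n * 1)"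
    by (intro landau_o.big.mult a_asymp) real_asymp
  have 2: "(\<lambda>n. (real n + \<alpha>) * (real (n + 1) powr (- 1/4) / real n powr (- 1/4))
      - (real n + \<alpha> - 1/4)) \<in> O(\<lambda>n. 1 / real n)"
    by real_asymp
  have "fwd n - (real n + \<alpha> - 1/4) =
      (a n - (real n + \<alpha>)) * r + ((real n + \<alpha>) * r - (real n + \<alpha> - 1/4))"
    if "r = real (n + 1) powr (- 1/4) / real n powr (- 1/4)" for n r
    unfolding fwd_def that[symmetric] by (simp add: left_diff_distrib)
  from this[OF refl] show ?thesis
    using sum_in_bigo(1)[OF 1[simplified mult_1_right] 2] by presburger
qed

lemma bwd_asymp: "(\<lambda>n. bwd n - (real n + \<alpha> - 3/4)) \<in> O(\<lambda>n. 1 / real n)"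
proof -
  have "filterlim (\<lambda>n::nat. n - 1) at_top at_top"
    by real_asymp
  from landau_o.big.compose[OF a_asymp this]
  have "(\<lambda>n. a (n - 1) - (real (n - 1) + \<alpha>)) \<in> O(\<lambda>n. 1 / real (n - 1))"
    by simp
  also have "(\<lambda>n. 1 / real (n - 1)) \<in> O(\<lambda>n. 1 / real n)"
    by real_asymp
  finally have shifted: "(\<lambda>n. a (n - 1) - (real (n - 1) + \<alpha>)) \<in> O(\<lambda>n. 1 / real n)" .
  have 1: "(\<lambda>n. (a (n - 1) - (real (n - 1) + \<alpha>)) * (real (n - 1) powr (- 1/4) / real n powr (- 1/4)))
      \<in> O(\<lambda>n. 1 / real n * 1)"
    by (intro landau_o.big.mult shifted) real_asymp
  have 2: "(\<lambda>n. (real (n - 1) + \<alpha>) * (real (n - 1) powr (- 1/4) / real n powr (- 1/4))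
      - (real n + \<alpha> - 3/4)) \<in> O(\<lambda>n. 1 / real n)"
    by real_asymp
  have "bwd n - (real n + \<alpha> - 3/4) =
      (a (n - 1) - (real (n - 1) + \<alpha>)) * r + ((real (n - 1) + \<alpha>) * r - (real n + \<alpha> - 3/4))"
    if "r = real (n - 1) powr (- 1/4) / real n powr (- 1/4)" for n r
    unfolding bwd_def that[symmetric] by (simp add: left_diff_distrib)
  from this[OF refl] show ?thesis
    using sum_in_bigo(1)[OF 1[simplified mult_1_right] 2] by presburger
qed

text \<open>
  The next four facts are the coefficients of $1$, $w$ and $w^3$, $w^2$, and the remainder, in the
  Taylor expansion of the residual in powers of $w$. Each is $O(1/n)$ because the leading terms
  cancel: for the constant term by the choice of $\tau$, for the odd powers by the exponent $-1/4$,
  for the quadratic term because $2 \cdot n \cdot (n^{-1/2})^2 = 2$.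
\<close>

lemma Taylor_moment_0: "(\<lambda>n. fwd n + bwd n - c n + \<tau>) \<in> O(\<lambda>n. 1 / real n)"
  using sum_in_bigo(2)[OF sum_in_bigo(1)[OF fwd_asymp bwd_asymp] c_asymp]
  by (simp add: tau_eq algebra_simps)

lemma Taylor_moment_odd:
  assumes "j \<in> {1, 3}"
  shows "(\<lambda>n. fwd n * h (n + 1) ^ j - bwd n * h n ^ j) \<in> O(\<lambda>n. 1 / real n)"
proof -
  have 1: "(\<lambda>n. (fwd n - (real n + \<alpha> - 1/4)) * h (n + 1) ^ j) \<in> O(\<lambda>n. 1 / real n * 1)"
    using assms by (intro landau_o.big.mult fwd_asymp) (auto; real_asymp)
  have 2: "(\<lambda>n. (bwd n - (real n + \<alpha> - 3/4)) * h n ^ j) \<in> O(\<lambda>n. 1 / real n * 1)"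
    using assms by (intro landau_o.big.mult bwd_asymp) (auto; real_asymp)
  have 3: "(\<lambda>n. (real n + \<alpha> - 1/4) * h (n + 1) ^ j - (real n + \<alpha> - 3/4) * h n ^ j)
      \<in> O(\<lambda>n. 1 / real n)"
    using assms by (auto; real_asymp)
  from sum_in_bigo(1)[OF sum_in_bigo(2)[OF 1[unfolded mult_1_right] 2[unfolded mult_1_right]] 3]
  show ?thesis
    by (simp add: algebra_simps)
qed

lemma Taylor_moment_2:
  "(\<lambda>n. 2 - (fwd n * h (n + 1) ^ 2 + bwd n * h n ^ 2)) \<in> O(\<lambda>n. 1 / real n)"
proof -
  have 1: "(\<lambda>n. (fwd n - (real n + \<alpha> - 1/4)) * h (n + 1) ^ 2) \<in> O(\<lambda>n. 1 / real n * 1)"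
    by (intro landau_o.big.mult fwd_asymp) real_asymp
  have 2: "(\<lambda>n. (bwd n - (real n + \<alpha> - 3/4)) * h n ^ 2) \<in> O(\<lambda>n. 1 / real n * 1)"
    by (intro landau_o.big.mult bwd_asymp) real_asymp
  have 3: "(\<lambda>n. 2 - ((real n + \<alpha> - 1/4) * h (n + 1) ^ 2 + (real n + \<alpha> - 3/4) * h n ^ 2))
      \<in> O(\<lambda>n. 1 / real n)"
    by real_asymp
  from sum_in_bigo(2)[OF 3 sum_in_bigo(1)[OF 1 2, simplified]] show ?thesis
    by (simp add: algebra_simps)
qed

lemma Taylor_moment_4:
  "(\<lambda>n. \<bar>fwd n\<bar> * h (n + 1) ^ 4 + \<bar>bwd n\<bar> * h n ^ 4) \<in> O(\<lambda>n. 1 / real n)"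
proof -
  have fwd_linear: "fwd \<in> O(\<lambda>n. real n)"
  proof -
    have "(\<lambda>n. fwd n - (real n + \<alpha> - 1/4)) \<in> O(\<lambda>n. real n)"
      by (rule landau_o.big.trans[OF fwd_asymp]) real_asymp
    moreover have "(\<lambda>n. real n + \<alpha> - 1/4) \<in> O(\<lambda>n. real n)"
      by real_asymp
    ultimately show ?thesis
      using sum_in_bigo(1) by fastforce
  qed
  have bwd_linear: "bwd \<in> O(\<lambda>n. real n)"
  proof -
    have "(\<lambda>n. bwd n - (real n + \<alpha> - 3/4)) \<in> O(\<lambda>n. real n)"
      by (rule landau_o.big.trans[OF bwd_asymp]) real_asymp
    moreover have "(\<lambda>n. real n + \<alpha> - 3/4) \<in> O(\<lambda>n. real n)"
      by real_asymp
    ultimately show ?thesis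
      using sum_in_bigo(1) by fastforce
  qed
  have "(\<lambda>n. \<bar>fwd n\<bar> * h (n + 1) ^ 4) \<in> O(\<lambda>n. real n * (1 / real n ^ 2))"
    using fwd_linear by (intro landau_o.big.mult) (simp, real_asymp)
  moreover have "(\<lambda>n. \<bar>bwd n\<bar> * h n ^ 4) \<in> O(\<lambda>n. real n * (1 / real n ^ 2))"
    using bwd_linear by (intro landau_o.big.mult) (simp, real_asymp)
  ultimately show ?thesis
    using sum_in_bigo(1) by (fastforce simp: power2_eq_square)
qed

text \<open>
  The modulus of $1 / (a_k A_k A_{k+1})$ at $w = 0$ agrees with the step $(k+1)^{-1/2}$ of the phase
  to an order that is summable; this is what makes the sums of these reciprocals telescope.
\<close>

lemma weight_asymp:
  "(\<lambda>k. real k powr (1/4) * real (k + 1) powr (1/4) / a k - h (k + 1))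
     \<in> O(\<lambda>k. real k powr (- 3/2))"
proof -
  have "(\<lambda>k. a k - real k) \<in> O(\<lambda>k. 1)"
  proof -
    have "(\<lambda>k. a k - (real k + \<alpha>)) \<in> O(\<lambda>k. 1)"
      by (rule landau_o.big.trans[OF a_asymp]) real_asymp
    from sum_in_bigo(1)[OF this, of "\<lambda>_. \<alpha>"] show ?thesis by simp
  qed
  note a1 = this
  have a1': "(\<lambda>k. real k - a k) \<in> O(\<lambda>k. 1)"
    using landau_o.big.uminus_in_iff[of "\<lambda>k. a k - real k"] a1 by simp
  have "(\<lambda>k. a k - real k) \<in> o(\<lambda>k. real k)"
    by (rule landau_o.big_small_trans[OF a1]) real_asymp
  then have a2: "a \<sim>[at_top] (\<lambda>k. real k)"
    by (simp add: asymp_equiv_altdef)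
  have inv: "(\<lambda>k. 1 / a k) \<in> O(\<lambda>k. 1 / real k)"
    using asymp_equiv_imp_bigo[OF asymp_equiv_inverse[OF a2]] by (simp add: field_simps)
  have "(\<lambda>k. (real k - a k) * (1 / a k) * h (k + 1)) \<in> O(\<lambda>k. 1 * (1 / real k) * real k powr (-1/2))"
    using a1' by (intro landau_o.big.mult inv) (assumption, real_asymp)
  also have "(\<lambda>k. 1 * (1 / real k) * real k powr (-1/2)) \<in> O(\<lambda>k. real k powr (- 3/2))"
    by real_asymp
  finally have 1: "(\<lambda>k. (real k - a k) * (1 / a k) * h (k + 1)) \<in> O(\<lambda>k. real k powr (- 3/2))" .
  have "(\<lambda>k. 1 / a k * (real k powr (1/4) * real (k + 1) powr (1/4) - real k * h (k + 1)))
    \<in> O(\<lambda>k. 1 / real k * real k powr (- 1/2))"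
    by (intro landau_o.big.mult inv) real_asymp
  also have "(\<lambda>k. 1 / real k * real k powr (- 1/2)) \<in> O(\<lambda>k. real k powr (- 3/2))"
    by real_asymp
  finally have 2: "(\<lambda>k. 1 / a k * (real k powr (1/4) * real (k + 1) powr (1/4) - real k * h (k + 1)))
    \<in> O(\<lambda>k. real k powr (- 3/2))" .
  have "x / a k - y = (real k - a k) * (1 / a k) * y + 1 / a k * (x - real k * y)" for k x y
    using a_pos[of k] by (simp add: field_simps)
  from this show ?thesis
    using sum_in_bigo(1)[OF 1 2] by presburger
qed

section \<open>The ansatz, its residual and the Green function\<close>

definition phase :: "nat \<Rightarrow> real" where
  "phase n = (\<Sum>m = 1..n. h m)"

definition ansatz :: "complex \<Rightarrow> nat \<Rightarrow> complex" where
  "ansatz w n = complex_of_real (real n powr (- (1 / 4))) * exp (\<i> * w * complex_of_real (phase n))"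

definition residual :: "complex \<Rightarrow> nat \<Rightarrow> complex" where
  "residual w n = (complex_of_real (a n) * ansatz w (n + 1) + complex_of_real (a (n - 1)) * ansatz w (n - 1)) / ansatz w n
     - (complex_of_real (c n - \<tau>) - w\<^sup>2)"

lemma phase_Suc: "phase (Suc n) = phase n + h (Suc n)"
  by (simp add: phase_def)

lemma phase_mono: "m \<le> n \<Longrightarrow> phase m \<le> phase n"
  unfolding phase_def by (intro sum_mono2) auto

lemma ansatz_nonzero: "n \<ge> 1 \<Longrightarrow> ansatz w n \<noteq> 0"
  by (simp add: ansatz_def)

lemma norm_ansatz: "norm (ansatz w n) = real n powr (- (1 / 4)) * exp (- (Im w * phase n))"
  by (simp add: ansatz_def norm_mult)

lemma h_le_1: "h n \<le> 1"
  by (cases "n = 0") (auto simp: powr_minus_divide ge_one_powr_ge_zero)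

lemma norm_ansatz_le_1:
  assumes "Im w \<ge> 0"
  shows "norm (ansatz w n) \<le> 1"
proof -
  have "real n powr (- (1 / 4)) \<le> 1"
    by (cases "n = 0") (auto simp: powr_minus_divide ge_one_powr_ge_zero)
  moreover have "phase n \<ge> 0"
    unfolding phase_def by (intro sum_nonneg) auto
  ultimately have "real n powr (- (1 / 4)) * exp (- (Im w * phase n)) \<le> 1 * 1"
    using assms by (intro mult_mono) auto
  then show ?thesis
    by (simp add: norm_ansatz)
qed

lemma residual_eq:
  assumes "n \<ge> 1"
  shows "residual w n = complex_of_real (fwd n) * exp (\<i> * w * complex_of_real (h (n + 1)))
      + complex_of_real (bwd n) * exp (- (\<i> * w * complex_of_real (h n)))
      - (complex_of_real (c n - \<tau>) - w\<^sup>2)"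
proof -
  have "phase n = phase (n - 1) + h n"
    using phase_Suc[of "n - 1"] assms by simp
  then have ratio: "ansatz w (n - 1) / ansatz w n
      = complex_of_real (real (n - 1) powr (- (1 / 4)) / real n powr (- (1 / 4)))
        * exp (- (\<i> * w * complex_of_real (h n)))"
    using assms by (simp add: ansatz_def exp_add exp_minus ring_distribs field_simps)
  have "ansatz w (n + 1) / ansatz w n
      = complex_of_real (real (n + 1) powr (- (1 / 4)) / real n powr (- (1 / 4)))
        * exp (\<i> * w * complex_of_real (h (n + 1)))"
    using assms phase_Suc[of n] by (simp add: ansatz_def exp_add ring_distribs field_simps)
  with ratio show ?thesis
    unfolding residual_def add_divide_distrib times_divide_eq_right[symmetric]
    by (simp add: fwd_def bwd_def mult.assoc)
qed

text \<open>
  Third order Taylor expansion of both exponentials. The coefficients are real sequences that do not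
  involve $w$, so the bound is automatically uniform for $w$ in a disc.
\<close>

lemma residual_bound:
  obtains C where "C \<ge> 0"
    "\<And>w n. norm w \<le> L \<Longrightarrow> n \<ge> 1 \<Longrightarrow> norm (residual w n) \<le> C / real n"
proof -
  have pos: "\<And>n. n \<ge> 1 \<Longrightarrow> 1 / real n > 0" by simp
  obtain C0 where C0: "\<And>n. n \<ge> 1 \<Longrightarrow> \<bar>fwd n + bwd n - c n + \<tau>\<bar> \<le> C0 * (1 / real n)"
    using bigo_imp_bound_from_1[OF Taylor_moment_0 pos] by blast
  obtain C1 where C1: "\<And>n. n \<ge> 1 \<Longrightarrow> \<bar>fwd n * h (n + 1) ^ 1 - bwd n * h n ^ 1\<bar> \<le> C1 * (1 / real n)"
    using bigo_imp_bound_from_1[OF Taylor_moment_odd[of 1] pos] by blast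
  obtain C2 where C2: "\<And>n. n \<ge> 1 \<Longrightarrow> \<bar>2 - (fwd n * h (n + 1) ^ 2 + bwd n * h n ^ 2)\<bar> \<le> C2 * (1 / real n)"
    using bigo_imp_bound_from_1[OF Taylor_moment_2 pos] by blast
  obtain C3 where C3: "\<And>n. n \<ge> 1 \<Longrightarrow> \<bar>fwd n * h (n + 1) ^ 3 - bwd n * h n ^ 3\<bar> \<le> C3 * (1 / real n)"
    using bigo_imp_bound_from_1[OF Taylor_moment_odd[of 3] pos] by blast
  obtain C4 where C4: "\<And>n. n \<ge> 1 \<Longrightarrow> \<bar>\<bar>fwd n\<bar> * h (n + 1) ^ 4 + \<bar>bwd n\<bar> * h n ^ 4\<bar> \<le> C4 * (1 / real n)"
    using bigo_imp_bound_from_1[OF Taylor_moment_4 pos] by blast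
  define C where "C = C0 + L * C1 + L ^ 2 / 2 * C2 + L ^ 3 / 6 * C3 + exp L * L ^ 4 * C4"
  have bound: "norm (residual w n) \<le> C / real n" if w: "norm w \<le> L" and n: "n \<ge> 1" for w n
  proof -
    have L: "0 \<le> L"
      using w norm_ge_zero[of w] by linarith
    define x y where "x = h (n + 1)" and "y = h n"
    have xy: "0 \<le> x" "x \<le> 1" "0 \<le> y" "y \<le> 1"
      using h_le_1[of n] h_le_1[of "n + 1"] by (auto simp: x_def y_def)
    define e where "e z = exp z - (\<Sum>k\<le>3. z ^ k / fact k)" for z :: complex
    have e_bound: "norm (e (\<i> * w * of_real t)) \<le> exp L * L ^ 4 * \<bar>t\<bar> ^ 4" if "\<bar>t\<bar> \<le> 1" for t
    proof -
      have wt: "norm (\<i> * w * of_real t) \<le> L * \<bar>t\<bar>"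
        using w by (simp add: norm_mult mult_right_mono)
      moreover have "L * \<bar>t\<bar> \<le> L * 1"
        using that w norm_ge_zero[of w] by (intro mult_left_mono) linarith+
      ultimately have "norm (e (\<i> * w * of_real t)) \<le> exp L * norm (\<i> * w * of_real t) ^ 4"
        using norm_exp_minus_Taylor_le[of "\<i> * w * of_real t" L 3] by (simp add: e_def)
      also have "\<dots> \<le> exp L * (L * \<bar>t\<bar>) ^ 4"
        using wt by (intro mult_left_mono power_mono) auto
      finally show ?thesis
        by (simp add: power_mult_distrib mult.assoc)
    qed
    have expand: "exp (\<i> * w * of_real t) = 1 + \<i> * w * of_real t - w\<^sup>2 * of_real t ^ 2 / 2
        - \<i> * w ^ 3 * of_real t ^ 3 / 6 + e (\<i> * w * of_real t)" for t
      by (simp add: e_def atMost_nat_numeral fact_numeral power_mult_distrib power3_eq_cube)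
    have "residual w n = of_real (fwd n) * exp (\<i> * w * of_real x) + of_real (bwd n) * exp (\<i> * w * of_real (- y))
        - (of_real (c n - \<tau>) - w\<^sup>2)"
      unfolding residual_eq[OF n] by (simp add: x_def y_def)
    also have "\<dots> = of_real (fwd n + bwd n - c n + \<tau>) + \<i> * w * of_real (fwd n * x ^ 1 - bwd n * y ^ 1)
        + w\<^sup>2 / 2 * of_real (2 - (fwd n * x ^ 2 + bwd n * y ^ 2))
        - \<i> * w ^ 3 / 6 * of_real (fwd n * x ^ 3 - bwd n * y ^ 3)
        + (of_real (fwd n) * e (\<i> * w * of_real x) + of_real (bwd n) * e (\<i> * w * of_real (- y)))"
      unfolding expand by (simp add: field_simps)
    finally have split: "residual w n = \<dots>" .
    have "norm (residual w n) \<le> norm (complex_of_real (fwd n + bwd n - c n + \<tau>))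
        + norm (\<i> * w * of_real (fwd n * x ^ 1 - bwd n * y ^ 1))
        + norm (w\<^sup>2 / 2 * of_real (2 - (fwd n * x ^ 2 + bwd n * y ^ 2)))
        + norm (\<i> * w ^ 3 / 6 * of_real (fwd n * x ^ 3 - bwd n * y ^ 3))
        + norm (of_real (fwd n) * e (\<i> * w * of_real x) + of_real (bwd n) * e (\<i> * w * of_real (- y)))"
      unfolding split
      by (rule order_trans[OF norm_triangle_ineq add_right_mono],
          rule order_trans[OF norm_triangle_ineq4 add_right_mono],
          rule order_trans[OF norm_triangle_ineq add_right_mono], rule norm_triangle_ineq)
    moreover have "norm (complex_of_real (fwd n + bwd n - c n + \<tau>)) \<le> C0 / real n"
      using C0[OF n] by (simp only: norm_of_real) simp
    moreover have "norm (\<i> * w * of_real (fwd n * x ^ 1 - bwd n * y ^ 1)) \<le> L * (C1 * (1 / real n))"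
      unfolding norm_mult norm_of_real x_def y_def
      using C1[OF n] w L by (intro mult_mono) auto
    moreover have "norm (w\<^sup>2 / 2 * of_real (2 - (fwd n * x ^ 2 + bwd n * y ^ 2))) \<le> L ^ 2 / 2 * (C2 * (1 / real n))"
      unfolding norm_mult norm_of_real x_def y_def
      using C2[OF n] w L by (intro mult_mono) (auto simp: norm_divide norm_power intro!: power_mono)
    moreover have "norm (\<i> * w ^ 3 / 6 * of_real (fwd n * x ^ 3 - bwd n * y ^ 3)) \<le> L ^ 3 / 6 * (C3 * (1 / real n))"
      unfolding norm_mult norm_of_real x_def y_def
      using C3[OF n] w L by (intro mult_mono) (auto simp: norm_divide norm_mult norm_power intro!: power_mono)
    moreover have "norm (of_real (fwd n) * e (\<i> * w * of_real x) + of_real (bwd n) * e (\<i> * w * of_real (- y)))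
        \<le> exp L * L ^ 4 * (C4 * (1 / real n))"
    proof -
      have "norm (of_real (fwd n) * e (\<i> * w * of_real x) + of_real (bwd n) * e (\<i> * w * of_real (- y)))
          \<le> \<bar>fwd n\<bar> * (exp L * L ^ 4 * \<bar>x\<bar> ^ 4) + \<bar>bwd n\<bar> * (exp L * L ^ 4 * \<bar>- y\<bar> ^ 4)"
        using xy by (intro norm_triangle_mono)
          (auto simp only: norm_mult norm_of_real intro!: mult_left_mono e_bound)
      also have "\<dots> = exp L * L ^ 4 * \<bar>\<bar>fwd n\<bar> * x ^ 4 + \<bar>bwd n\<bar> * y ^ 4\<bar>"
        using xy by (simp add: algebra_simps)
      also have "\<dots> \<le> exp L * L ^ 4 * (C4 * (1 / real n))"
        unfolding x_def y_def by (intro mult_left_mono C4[OF n]) auto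
      finally show ?thesis .
    qed
    ultimately have "norm (residual w n) \<le> C0 / real n + L * (C1 * (1 / real n))
        + L ^ 2 / 2 * (C2 * (1 / real n)) + L ^ 3 / 6 * (C3 * (1 / real n)) + exp L * L ^ 4 * (C4 * (1 / real n))"
      by linarith
    also have "\<dots> = C / real n"
      by (simp add: C_def add_divide_distrib)
    finally show ?thesis .
  qed
  have "norm (residual w n) \<le> \<bar>C\<bar> / real n" if "norm w \<le> L" and "n \<ge> 1" for w n
    by (rule order_trans[OF bound[OF that]]) (simp add: divide_right_mono)
  then show ?thesis
    using that[of "\<bar>C\<bar>"] by simp
qed

definition green :: "complex \<Rightarrow> nat \<Rightarrow> nat \<Rightarrow> complex" where
  "green w n m = (\<Sum>k = n..<m. 1 / (complex_of_real (a k) * ansatz w k * ansatz w (k + 1)))"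

text \<open>
  With $B_k = e^{-2iwS_k}$ one has
  $B_{k+1} - B_k = e^{-iw(S_k+S_{k+1})} \cdot (-2i) \sin (w (k+1)^{-1/2})$, so the summand
  $1/(a_k A_k A_{k+1})$ equals $\frac{i}{2w} (B_{k+1} - B_k)$ up to an error $O(k^{-3/2})$ times
  $e^{-iw(S_k+S_{k+1})}$. All exponentials that occur are at most $e^{2 S_m \Im w}$ in modulus
  because $\Im w \ge 0$, and $|A_m|^2 = m^{-1/2} e^{-2 S_m \Im w}$ compensates for it. The
  factor $\frac{i}{2w}$ is where the lower bound on $|w|$ enters.
\<close>

lemma green_bound:
  assumes "\<delta> > 0"
  obtains C where "C \<ge> 0"
    "\<And>w n m. Im w \<ge> 0 \<Longrightarrow> \<delta> \<le> norm w \<Longrightarrow> norm w \<le> L \<Longrightarrow> 1 \<le> n \<Longrightarrow> n \<le> m \<Longrightarrow>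
       norm (green w n m * (ansatz w m)\<^sup>2) \<le> C * h m"
proof -
  define D where "D k = real k powr (1/4) * real (k + 1) powr (1/4) / a k" for k
  obtain CD where CD: "CD \<ge> 0" "\<And>k. k \<ge> 1 \<Longrightarrow> \<bar>D k - h (k + 1)\<bar> \<le> CD * real k powr (- 3/2)"
    using bigo_imp_bound_from_1[OF weight_asymp] unfolding D_def by auto
  have summable: "summable (\<lambda>k. real k powr (- 3/2))"
    by (subst summable_real_powr_iff) auto
  define Z where "Z = (\<Sum>k. real k powr (- 3/2))"
  define M where "M = CD + exp L * L\<^sup>2"
  define C where "C = 1 / \<delta> + M * Z"
  have "M \<ge> 0"
    using CD(1) by (simp add: M_def)
  have "Z \<ge> 0"
    unfolding Z_def by (rule suminf_nonneg[OF summable]) auto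
  have "norm (green w n m * (ansatz w m)\<^sup>2) \<le> C * h m"
    if w: "Im w \<ge> 0" "\<delta> \<le> norm w" "norm w \<le> L" and nm: "1 \<le> n" "n \<le> m" for w n m
  proof -
    have L: "0 \<le> L"
      using w norm_ge_zero[of w] by linarith
    have w0: "w \<noteq> 0" using w assms by auto
    define B where "B k = exp (- (2 * \<i> * w * of_real (phase k)))" for k
    define E where "E k = exp (- (\<i> * w * of_real (phase k + phase (k + 1))))" for k
    define p where "p = \<i> / (2 * w)"
    define d where "d t = exp (- (\<i> * w * of_real t)) - exp (\<i> * w * of_real t)" for t
    have term_eq: "1 / (complex_of_real (a k) * ansatz w k * ansatz w (k + 1))
        = p * (B (k + 1) - B k) + E k * (of_real (D k) - p * d (h (k + 1)))" if "k \<ge> 1" for k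
    proof -
      have "E k = inverse (exp (\<i> * w * of_real (phase k)) * exp (\<i> * w * of_real (phase (k + 1))))"
        unfolding E_def exp_minus exp_add[symmetric] by (simp add: ring_distribs)
      then have "1 / (complex_of_real (a k) * ansatz w k * ansatz w (k + 1)) = of_real (D k) * E k"
        using that a_pos[of k]
        by (simp add: ansatz_def D_def powr_minus field_simps del: of_nat_Suc)
      moreover have "B (k + 1) - B k = E k * d (h (k + 1))"
      proof -
        have "B (k + 1) = E k * exp (- (\<i> * w * of_real (h (k + 1))))"
          unfolding B_def E_def exp_add[symmetric]
          by (rule arg_cong[where f = exp]) (simp add: phase_Suc algebra_simps)
        moreover have "B k = E k * exp (\<i> * w * of_real (h (k + 1)))"
          unfolding B_def E_def exp_add[symmetric]
          by (rule arg_cong[where f = exp]) (simp add: phase_Suc algebra_simps)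
        ultimately show ?thesis
          by (simp only: d_def right_diff_distrib)
      qed
      ultimately show ?thesis
        by (simp add: algebra_simps)
    qed
    have norm_E: "norm (E k) \<le> exp (2 * Im w * phase m)" if "k < m" for k
    proof -
      have "phase k + phase (k + 1) \<le> 2 * phase m"
        using phase_mono[of k m] phase_mono[of "k + 1" m] that by simp
      from mult_left_mono[OF this w(1)] show ?thesis
        by (simp add: E_def)
    qed
    have norm_B: "norm (B k) \<le> exp (2 * Im w * phase m)" if "k \<le> m" for k
      using mult_left_mono[OF phase_mono[OF that] w(1)] by (simp add: B_def)
    \<comment> \<open>Here \<open>p * d t\<close> is $\sin(wt)/w$, and the claim is $\sin(wt)/w = t + O(t^3)$; the
      quadratic Taylor polynomials of the two exponentials are subtracted, so that the even terms cancel.\<close>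
    have d_bound: "norm (of_real t - p * d t) \<le> exp L * L\<^sup>2 * t ^ 3" if t: "0 \<le> t" "t \<le> 1" for t
    proof -
      define e where "e z = exp z - (\<Sum>k\<le>2. z ^ k / fact k)" for z :: complex
      have e_bound: "norm (e z) \<le> exp L * (norm w * t) ^ 3" if "norm z = norm w * t" for z
      proof -
        have "norm w * t \<le> L * 1"
          using t w L by (intro mult_mono) auto
        then show ?thesis
          using norm_exp_minus_Taylor_le[of z L 2] that by (simp add: e_def)
      qed
      have "d t = e (- (\<i> * w * of_real t)) - e (\<i> * w * of_real t) - 2 * \<i> * w * of_real t"
        by (simp add: d_def e_def atMost_nat_numeral fact_numeral)
      then have "p * d t = p * (e (- (\<i> * w * of_real t)) - e (\<i> * w * of_real t))
          - p * (2 * \<i> * w) * of_real t"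
        by (simp only: right_diff_distrib mult.assoc)
      moreover have "p * (2 * \<i> * w) = - 1"
        using w0 by (simp add: p_def)
      ultimately have "p * d t = p * (e (- (\<i> * w * of_real t)) - e (\<i> * w * of_real t)) + of_real t"
        by simp
      then have "norm (of_real t - p * d t)
          = norm p * norm (e (- (\<i> * w * of_real t)) - e (\<i> * w * of_real t))"
        by (simp add: norm_mult)
      also have "\<dots> \<le> norm p * (exp L * (norm w * t) ^ 3 + exp L * (norm w * t) ^ 3)"
        using t by (intro mult_left_mono order_trans[OF norm_triangle_ineq4] add_mono e_bound)
          (auto simp: norm_mult)
      also have "\<dots> = exp L * (norm w)\<^sup>2 * t ^ 3"
        using w0 by (simp add: p_def norm_divide norm_mult field_simps power2_eq_square power3_eq_cube)
      also have "\<dots> \<le> exp L * L\<^sup>2 * t ^ 3"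
        using w t by (intro mult_right_mono mult_left_mono power_mono) auto
      finally show ?thesis .
    qed
    have error: "norm (E k * (of_real (D k) - p * d (h (k + 1))))
        \<le> exp (2 * Im w * phase m) * (M * real k powr (- 3/2))" if k: "k \<in> {n..<m}" for k
    proof -
      have "k \<ge> 1" using k nm by simp
      have "h (k + 1) ^ 3 = real (k + 1) powr (- 3/2)"
        by (simp add: powr_power)
      also have "\<dots> \<le> real k powr (- 3/2)"
        using \<open>k \<ge> 1\<close> by (intro powr_mono2') auto
      finally have h3: "h (k + 1) ^ 3 \<le> real k powr (- 3/2)" .
      have "norm (of_real (D k) - p * d (h (k + 1)))
          \<le> norm (complex_of_real (D k - h (k + 1))) + norm (of_real (h (k + 1)) - p * d (h (k + 1)))"
        by (rule order_trans[OF _ norm_triangle_ineq]) simp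
      also have "\<dots> \<le> CD * real k powr (- 3/2) + exp L * L\<^sup>2 * h (k + 1) ^ 3"
        using CD(2)[OF \<open>k \<ge> 1\<close>] d_bound[of "h (k + 1)"] h_le_1[of "k + 1"]
        unfolding norm_of_real by (intro add_mono) auto
      also have "\<dots> \<le> CD * real k powr (- 3/2) + exp L * L\<^sup>2 * real k powr (- 3/2)"
        using h3 by (intro add_left_mono mult_left_mono) auto
      also have "\<dots> = M * real k powr (- 3/2)"
        by (simp add: M_def algebra_simps)
      finally show ?thesis
        unfolding norm_mult using k norm_E[of k] by (intro mult_mono) auto
    qed
    have "green w n m = p * (B m - B n) + (\<Sum>k = n..<m. E k * (of_real (D k) - p * d (h (k + 1))))"
    proof -
      have "green w n m = (\<Sum>k = n..<m. p * (B (Suc k) - B k) + E k * (of_real (D k) - p * d (h (k + 1))))"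
        unfolding green_def
      proof (rule sum.cong[OF refl])
        fix k assume "k \<in> {n..<m}"
        then have "k \<ge> 1" using nm by simp
        from term_eq[OF this] show "1 / (complex_of_real (a k) * ansatz w k * ansatz w (k + 1))
            = p * (B (Suc k) - B k) + E k * (of_real (D k) - p * d (h (k + 1)))"
          by simp
      qed
      then show ?thesis
        using sum_Suc_diff'[OF nm(2), of B] by (simp add: sum.distrib sum_distrib_left[symmetric])
    qed
    then have "norm (green w n m) \<le> norm (p * (B m - B n))
        + norm (\<Sum>k = n..<m. E k * (of_real (D k) - p * d (h (k + 1))))"
      by (simp add: norm_triangle_ineq)
    also have "\<dots> \<le> exp (2 * Im w * phase m) * (1 / \<delta>) + exp (2 * Im w * phase m) * (M * Z)"
    proof (rule add_mono)
      have "norm (p * (B m - B n)) \<le> 1 / (2 * \<delta>) * (exp (2 * Im w * phase m) + exp (2 * Im w * phase m))"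
        unfolding norm_mult
      proof (intro mult_mono order_trans[OF norm_triangle_ineq4] add_mono norm_B)
        have "norm p = 1 / (2 * norm w)"
          by (simp add: p_def norm_divide norm_mult)
        also have "\<dots> \<le> 1 / (2 * \<delta>)"
          using w assms by (intro frac_le) auto
        finally show "norm p \<le> 1 / (2 * \<delta>)" .
      qed (use assms nm in auto)
      then show "norm (p * (B m - B n)) \<le> exp (2 * Im w * phase m) * (1 / \<delta>)"
        using assms by (simp add: field_simps)
      have "norm (\<Sum>k = n..<m. E k * (of_real (D k) - p * d (h (k + 1))))
          \<le> (\<Sum>k = n..<m. exp (2 * Im w * phase m) * (M * real k powr (- 3/2)))"
        by (rule order_trans[OF norm_sum sum_mono]) (use error in auto)
      also have "\<dots> = exp (2 * Im w * phase m) * (M * (\<Sum>k = n..<m. real k powr (- 3/2)))"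
        by (simp add: sum_distrib_left)
      also have "\<dots> \<le> exp (2 * Im w * phase m) * (M * Z)"
        unfolding Z_def using \<open>M \<ge> 0\<close> summable
        by (intro mult_left_mono sum_le_suminf) auto
      finally show "norm (\<Sum>k = n..<m. E k * (of_real (D k) - p * d (h (k + 1))))
          \<le> exp (2 * Im w * phase m) * (M * Z)" .
    qed
    also have "\<dots> = exp (2 * Im w * phase m) * C"
      by (simp add: C_def ring_distribs)
    finally have green: "norm (green w n m) \<le> exp (2 * Im w * phase m) * C" .
    have "(real m powr (- (1 / 4)))\<^sup>2 = h m"
      by (simp add: power2_eq_square powr_add[symmetric])
    then have "norm ((ansatz w m)\<^sup>2) = h m * exp (- (2 * Im w * phase m))"
      unfolding norm_power norm_ansatz power_mult_distrib
      by (simp add: exp_double[symmetric] mult.assoc)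
    then have "norm (green w n m * (ansatz w m)\<^sup>2) \<le> exp (2 * Im w * phase m) * C * (h m * exp (- (2 * Im w * phase m)))"
      unfolding norm_mult using green by (simp add: mult_right_mono)
    then show ?thesis
      by (simp add: exp_minus field_simps)
  qed
  moreover have "C \<ge> 0"
    using assms \<open>M \<ge> 0\<close> \<open>Z \<ge> 0\<close> by (simp add: C_def)
  ultimately show ?thesis
    using that by blast
qed

section \<open>The Volterra equation and the Jost solution\<close>

text \<open>
  The exact solution that coincides with the ansatz from index $N$ on, computed downwards; it
  satisfies the recurrence at the indices up to $N$ only. Positivity of $a_0$ makes the
  value at index $0$ available as well.
\<close>

function truncated :: "complex \<Rightarrow> nat \<Rightarrow> nat \<Rightarrow> complex" where
  "truncated w N n = (if n \<ge> N then ansatz w n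
     else ((complex_of_real (c (n + 1) - \<tau>) - w\<^sup>2) * truncated w N (n + 1)
            - complex_of_real (a (n + 1)) * truncated w N (n + 2)) / complex_of_real (a n))"
  by pat_completeness auto
termination
  by (relation "Wellfounded.measure (\<lambda>(w, N, n). N - n)") auto

declare truncated.simps [simp del]

lemma truncated_ge: "n \<ge> N \<Longrightarrow> truncated w N n = ansatz w n"
  by (simp add: truncated.simps[of w N n])

lemma truncated_recurrence:
  assumes "1 \<le> n" "n \<le> N"
  shows "complex_of_real (a (n - 1)) * truncated w N (n - 1) + complex_of_real (a n) * truncated w N (n + 1)
    = (complex_of_real (c n - \<tau>) - w\<^sup>2) * truncated w N n"
  using assms a_pos[of "n - 1"] truncated.simps[of w N "n - 1"] by (auto simp: field_simps)

lemma green_rec: "n < m \<Longrightarrow>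
    green w n m = 1 / (complex_of_real (a n) * ansatz w n * ansatz w (n + 1)) + green w (Suc n) m"
  unfolding green_def by (simp add: sum.atLeast_Suc_lessThan)

text \<open>
  The Casoratian of the ansatz and an exact solution is not constant only because of the residual,
  and it vanishes at $N$, where the two agree at two consecutive indices.
\<close>

lemma casoratian_eq:
  assumes "k \<le> N"
  shows "complex_of_real (a k) * (ansatz w k * truncated w N (k + 1) - ansatz w (k + 1) * truncated w N k)
    = (\<Sum>m\<in>{k<..N}. residual w m * ansatz w m * truncated w N m)"
  using assms
proof (induction k rule: inc_induct)
  case base
  show ?case
    by (simp add: truncated_ge)
next
  case (step k)
  have "complex_of_real (a (k + 1)) * ansatz w (k + 2) + complex_of_real (a k) * ansatz w k
      = (residual w (k + 1) + (complex_of_real (c (k + 1) - \<tau>) - w\<^sup>2)) * ansatz w (k + 1)"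
    using ansatz_nonzero[of "k + 1" w] by (simp add: residual_def)
  moreover have "complex_of_real (a k) * truncated w N k + complex_of_real (a (k + 1)) * truncated w N (k + 2)
    = (complex_of_real (c (k + 1) - \<tau>) - w\<^sup>2) * truncated w N (k + 1)"
    using truncated_recurrence[of "k + 1" N w] step.hyps by simp
  ultimately have "complex_of_real (a k) * (ansatz w k * truncated w N (k + 1) - ansatz w (k + 1) * truncated w N k)
      = complex_of_real (a (k + 1)) * (ansatz w (k + 1) * truncated w N (k + 2) - ansatz w (k + 2) * truncated w N (k + 1))
        + residual w (k + 1) * ansatz w (k + 1) * truncated w N (k + 1)"
    by algebra
  moreover have "{k<..N} = insert (Suc k) {Suc k<..N}"
    using step.hyps by auto
  ultimately show ?case
    using step.IH by simp
qed

text \<open>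
  Dividing the Casoratian at $k$ by $a_k A_k A_{k+1}$ gives the difference $u_{k+1} - u_k$ of
  $u = G / A$; summation from $n$ to $N$ and $u_N = 1$ yield the equation.
\<close>

lemma volterra_equation:
  assumes "1 \<le> n" "n \<le> N"
  shows "truncated w N n / ansatz w n
    = 1 - (\<Sum>m\<in>{n<..N}. green w n m * (ansatz w m)\<^sup>2 * residual w m * (truncated w N m / ansatz w m))"
proof -
  define X where "X m = residual w m * ansatz w m * truncated w N m" for m
  have "truncated w N n / ansatz w n = 1 - (\<Sum>m\<in>{n<..N}. green w n m * X m)"
    using assms(2,1)
  proof (induction n rule: inc_induct)
    case base
    then show ?case
      using ansatz_nonzero[of N w] by (simp add: truncated_ge)
  next
    case (step n)
    define t where "t = 1 / (complex_of_real (a n) * ansatz w n * ansatz w (n + 1))"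
    have split: "{n<..N} = insert (Suc n) {Suc n<..N}"
      using step.hyps by auto
    have "(\<Sum>m\<in>{n<..N}. green w n m * X m) = (\<Sum>m\<in>{n<..N}. t * X m + green w (Suc n) m * X m)"
      by (intro sum.cong) (auto simp: green_rec t_def ring_distribs)
    also have "\<dots> = t * (\<Sum>m\<in>{n<..N}. X m) + (\<Sum>m\<in>{n<..N}. green w (Suc n) m * X m)"
      by (simp add: sum.distrib sum_distrib_left)
    also have "(\<Sum>m\<in>{n<..N}. green w (Suc n) m * X m) = (\<Sum>m\<in>{Suc n<..N}. green w (Suc n) m * X m)"
      unfolding split by (simp add: green_def)
    also have "t * (\<Sum>m\<in>{n<..N}. X m) = truncated w N (n + 1) / ansatz w (n + 1) - truncated w N n / ansatz w n"
      using casoratian_eq[of n N w] step ansatz_nonzero[of n w] ansatz_nonzero[of "n + 1" w] a_pos[of n]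
      unfolding X_def[symmetric] t_def
      by (simp add: field_simps)
    finally show ?case
      using step by simp
  qed
  also have "(\<Sum>m\<in>{n<..N}. green w n m * X m)
      = (\<Sum>m\<in>{n<..N}. green w n m * (ansatz w m)\<^sup>2 * residual w m * (truncated w N m / ansatz w m))"
    by (intro sum.cong) (auto simp: X_def power2_eq_square ansatz_nonzero)
  finally show ?thesis .
qed

text \<open>
  Half-annuli exhaust the punctured closed half-plane and serve as its compact subsets.
\<close>

definition annulus :: "real \<Rightarrow> real \<Rightarrow> complex set" where
  "annulus \<delta> L = {w. Im w \<ge> 0 \<and> \<delta> \<le> norm w \<and> norm w \<le> L}"

lemma volterra_kernel_le_summable:
  assumes "\<delta> > 0"
  obtains q :: "nat \<Rightarrow> real" where "\<And>m. q m \<ge> 0" "summable q"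
    "\<And>w n m. w \<in> annulus \<delta> L \<Longrightarrow> 1 \<le> n \<Longrightarrow> n < m \<Longrightarrow>
       norm (green w n m * (ansatz w m)\<^sup>2 * residual w m) \<le> q m"
proof -
  obtain C where C: "C \<ge> 0" "\<And>w n m. Im w \<ge> 0 \<Longrightarrow> \<delta> \<le> norm w \<Longrightarrow> norm w \<le> L \<Longrightarrow> 1 \<le> n \<Longrightarrow> n \<le> m \<Longrightarrow>
       norm (green w n m * (ansatz w m)\<^sup>2) \<le> C * h m"
    using green_bound[OF assms, of L] by blast
  obtain C' where C': "C' \<ge> 0" "\<And>w n. norm w \<le> L \<Longrightarrow> n \<ge> 1 \<Longrightarrow> norm (residual w n) \<le> C' / real n"
    using residual_bound[of L] by blast
  define q where "q m = C * C' * real m powr (- 3/2)" for m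
  have "norm (green w n m * (ansatz w m)\<^sup>2 * residual w m) \<le> q m"
    if "w \<in> annulus \<delta> L" "1 \<le> n" "n < m" for w n m
  proof -
    have "norm (green w n m * (ansatz w m)\<^sup>2 * residual w m) \<le> C * h m * (C' / real m)"
      unfolding norm_mult[of _ "residual w m"]
      using that C C'(1) by (intro mult_mono C(2) C'(2)) (auto simp: annulus_def)
    also have "\<dots> = q m"
    proof -
      have "real m powr (- 3/2) * real m = real m powr (- 3/2 + 1)"
        using that by (subst powr_add) simp
      then show ?thesis
        using that by (simp add: q_def field_simps)
    qed
    finally show ?thesis .
  qed
  moreover have "summable q"
    unfolding q_def by (intro summable_mult) (simp add: summable_real_powr_iff)
  moreover have "q m \<ge> 0" for m
    using C(1) C'(1) by (simp add: q_def)
  ultimately show ?thesis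
    using that by blast
qed

text \<open>
  Here \<open>T\<close> is the tail of a summable majorant of the kernel and \<open>n0\<close> is chosen so that this tail is
  at most $1/2$ there. The discrete Gronwall inequality gives $|u| \le 2$, which put back into the
  Volterra equation gives the first estimate. For the second, the difference of two truncations
  satisfies the same equation with the part of the sum between $N$ and $N'$ as its free term.
\<close>

lemma truncated_estimates:
  assumes "\<delta> > 0"
  obtains T :: "nat \<Rightarrow> real" and n0 where "T \<longlonglongrightarrow> 0" "n0 \<ge> 1"
    "\<And>w n N. w \<in> annulus \<delta> L \<Longrightarrow> n0 \<le> n \<Longrightarrow> n \<le> N \<Longrightarrow>
       norm (truncated w N n / ansatz w n - 1) \<le> 2 * T n"
    "\<And>w n N N'. w \<in> annulus \<delta> L \<Longrightarrow> n0 \<le> n \<Longrightarrow> n \<le> N \<Longrightarrow> N \<le> N' \<Longrightarrow>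
       norm (truncated w N' n / ansatz w n - truncated w N n / ansatz w n) \<le> 4 * T N"
proof -
  obtain q where q: "\<And>m. q m \<ge> 0" "summable q"
    and kernel: "\<And>w n m. w \<in> annulus \<delta> L \<Longrightarrow> 1 \<le> n \<Longrightarrow> n < m \<Longrightarrow>
       norm (green w n m * (ansatz w m)\<^sup>2 * residual w m) \<le> q m"
    using volterra_kernel_le_summable[OF assms, of L] by blast
  define T where "T n = suminf q - (\<Sum>m\<le>n. q m)" for n
  have "T \<longlonglongrightarrow> suminf q - suminf q"
    unfolding T_def by (intro tendsto_diff tendsto_const summable_LIMSEQ' q)
  then have T: "T \<longlonglongrightarrow> 0" by simp
  have tail: "(\<Sum>m\<in>{n<..N}. q m) \<le> T n" if "n \<le> N" for n N
  proof -
    have "{..N} = {..n} \<union> {n<..N}"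
      using that by auto
    then have "(\<Sum>m\<le>N. q m) = (\<Sum>m\<le>n. q m) + (\<Sum>m\<in>{n<..N}. q m)"
      by (simp only:, subst sum.union_disjoint) auto
    moreover have "(\<Sum>m\<le>N. q m) \<le> suminf q"
      using q by (intro sum_le_suminf) auto
    ultimately show ?thesis
      by (simp add: T_def)
  qed
  have T_nonneg: "T n \<ge> 0" for n
    using tail[of n n] by simp
  have "eventually (\<lambda>n. T n < 1 / 2) at_top"
    using T by (rule order_tendstoD) simp
  then obtain n1 where n1: "\<And>n. n \<ge> n1 \<Longrightarrow> T n < 1 / 2"
    by (auto simp: eventually_at_top_linorder)
  define n0 where "n0 = max n1 1"
  have n0: "n0 \<ge> 1" "T n0 \<le> 1 / 2"
    using n1[of n0] by (auto simp: n0_def)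
  have tail_n0: "(\<Sum>m\<in>{n0<..N}. q m) \<le> 1 / 2" for N
    using tail[of n0 N] n0(2) by (cases "n0 \<le> N") auto
  define u where "u w N n = truncated w N n / ansatz w n" for w N n
  have volterra: "u w N n = 1 - (\<Sum>m\<in>{n<..N}. green w n m * (ansatz w m)\<^sup>2 * residual w m * u w N m)"
    if "n0 \<le> n" "n \<le> N" for w N n
    unfolding u_def using volterra_equation[of n N w] that n0(1) by simp
  have integral_bound: "norm (\<Sum>m\<in>M. green w n m * (ansatz w m)\<^sup>2 * residual w m * x m)
      \<le> (\<Sum>m\<in>M. q m * norm (x m))"
    if "w \<in> annulus \<delta> L" "n0 \<le> n" "M \<subseteq> {n<..}" for w n M and x :: "nat \<Rightarrow> complex"
    using that n0(1)
    by (intro order_trans[OF norm_sum sum_mono], subst norm_mult, intro mult_right_mono kernel) auto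
  have bound: "norm (u w N n) \<le> 2" if w: "w \<in> annulus \<delta> L" and n: "n0 \<le> n" "n \<le> N" for w N n
  proof -
    have "norm (u w N n) \<le> 2 * 1"
    proof (rule volterra_bound[where q = q and ?n0.0 = n0 and N = N and u = "\<lambda>n. norm (u w N n)"])
      fix n assume n: "n0 \<le> n" "n \<le> N"
      have "norm (u w N n) \<le> norm (1 :: complex)
          + norm (\<Sum>m\<in>{n<..N}. green w n m * (ansatz w m)\<^sup>2 * residual w m * u w N m)"
        by (subst volterra[OF n]) (rule norm_triangle_ineq4)
      also have "\<dots> \<le> 1 + (\<Sum>m\<in>{n<..N}. q m * norm (u w N m))"
        by (intro add_mono integral_bound w n) auto
      finally show "norm (u w N n) \<le> 1 + (\<Sum>m\<in>{n<..N}. q m * norm (u w N m))" .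
    qed (use q tail_n0 n in auto)
    then show ?thesis by simp
  qed
  have "norm (u w N n - 1) \<le> 2 * T n" if w: "w \<in> annulus \<delta> L" and n: "n0 \<le> n" "n \<le> N" for w N n
  proof -
    have "norm (u w N n - 1) = norm (\<Sum>m\<in>{n<..N}. green w n m * (ansatz w m)\<^sup>2 * residual w m * u w N m)"
      by (subst volterra[OF n]) simp
    also have "\<dots> \<le> (\<Sum>m\<in>{n<..N}. q m * norm (u w N m))"
      by (rule integral_bound) (use w n in auto)
    also have "\<dots> \<le> (\<Sum>m\<in>{n<..N}. q m * 2)"
      using n by (intro sum_mono mult_left_mono bound w q) auto
    also have "\<dots> \<le> 2 * T n"
      using tail[OF n(2)] by (simp add: sum_distrib_right[symmetric])
    finally show ?thesis .
  qed
  moreover have "norm (u w N' n - u w N n) \<le> 4 * T N"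
    if w: "w \<in> annulus \<delta> L" and n: "n0 \<le> n" "n \<le> N" "N \<le> N'" for w N N' n
  proof -
    have "norm (u w N' n - u w N n) \<le> 2 * (2 * T N)"
    proof (rule volterra_bound[where q = q and ?n0.0 = n0 and N = N and u = "\<lambda>n. norm (u w N' n - u w N n)"])
      fix n assume n: "n0 \<le> n" "n \<le> N"
      define k where "k m = green w n m * (ansatz w m)\<^sup>2 * residual w m" for m
      have "{n<..N'} = {n<..N} \<union> {N<..N'}"
        using n \<open>N \<le> N'\<close> by auto
      then have "(\<Sum>m\<in>{n<..N'}. k m * u w N' m) = (\<Sum>m\<in>{n<..N}. k m * u w N' m) + (\<Sum>m\<in>{N<..N'}. k m * u w N' m)"
        by (simp only:, subst sum.union_disjoint) auto
      then have "u w N' n - u w N n = - (\<Sum>m\<in>{n<..N}. k m * (u w N' m - u w N m)) - (\<Sum>m\<in>{N<..N'}. k m * u w N' m)"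
        using volterra[of n N' w] volterra[of n N w] n \<open>N \<le> N'\<close>
        by (simp add: k_def[symmetric] right_diff_distrib sum_subtractf)
      then have "norm (u w N' n - u w N n)
          \<le> norm (\<Sum>m\<in>{n<..N}. k m * (u w N' m - u w N m)) + norm (\<Sum>m\<in>{N<..N'}. k m * u w N' m)"
        by (metis norm_minus_cancel norm_triangle_ineq4)
      also have "\<dots> \<le> (\<Sum>m\<in>{n<..N}. q m * norm (u w N' m - u w N m)) + (\<Sum>m\<in>{N<..N'}. q m * norm (u w N' m))"
        unfolding k_def using w n by (intro add_mono integral_bound) auto
      also have "(\<Sum>m\<in>{N<..N'}. q m * norm (u w N' m)) \<le> (\<Sum>m\<in>{N<..N'}. q m * 2)"
        using n by (intro sum_mono mult_left_mono bound w q) auto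
      also have "\<dots> \<le> 2 * T N"
        using tail[OF \<open>N \<le> N'\<close>] by (simp add: sum_distrib_right[symmetric])
      finally show "norm (u w N' n - u w N n) \<le> 2 * T N + (\<Sum>m\<in>{n<..N}. q m * norm (u w N' m - u w N m))"
        by simp
    qed (use q tail_n0 n T_nonneg in auto)
    then show ?thesis by simp
  qed
  ultimately show ?thesis
    using that[OF T n0(1)] unfolding u_def by blast
qed

text \<open>
  The estimates above only reach down to an index depending on the half-annulus. The finitely many
  remaining values are obtained by backward recursion, whose coefficients are bounded there.
\<close>

lemma truncated_uniformly_Cauchy:
  assumes "\<delta> > 0"
  shows "uniformly_Cauchy_on (annulus \<delta> L) (\<lambda>N w. truncated w N n)"
proof -
  obtain T n0 where T: "T \<longlonglongrightarrow> 0" and n0: "n0 \<ge> 1"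
    and est: "\<And>w n N N'. w \<in> annulus \<delta> L \<Longrightarrow> n0 \<le> n \<Longrightarrow> n \<le> N \<Longrightarrow> N \<le> N' \<Longrightarrow>
       norm (truncated w N' n / ansatz w n - truncated w N n / ansatz w n) \<le> 4 * T N"
    using truncated_estimates[OF assms, of L] by metis
  have "\<exists>C\<ge>0. \<forall>w\<in>annulus \<delta> L. \<forall>N N'. max n (n0 + 1) \<le> N \<longrightarrow> N \<le> N' \<longrightarrow>
      norm (truncated w N' n - truncated w N n) \<le> C * T N"
  proof (induction "n0 - n" arbitrary: n rule: less_induct)
    case less
    show ?case
    proof (cases "n0 \<le> n")
      case True
      have "norm (truncated w N' n - truncated w N n) \<le> 4 * T N"
        if w: "w \<in> annulus \<delta> L" and N: "max n (n0 + 1) \<le> N" "N \<le> N'" for w N N'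
      proof -
        have "truncated w N' n - truncated w N n = ansatz w n * (truncated w N' n / ansatz w n - truncated w N n / ansatz w n)"
          using ansatz_nonzero[of n w] True n0 by (simp add: field_simps)
        then have "norm (truncated w N' n - truncated w N n)
            = norm (ansatz w n) * norm (truncated w N' n / ansatz w n - truncated w N n / ansatz w n)"
          by (simp add: norm_mult)
        also have "\<dots> \<le> 1 * (4 * T N)"
          using w N True by (intro mult_mono est norm_ansatz_le_1) (auto simp: annulus_def)
        finally show ?thesis by simp
      qed
      then show ?thesis
        by (intro exI[of _ 4]) auto
    next
      case False
      have "n0 - (n + 1) < n0 - n" "n0 - (n + 2) < n0 - n"
        using False by auto
      from this[THEN less.hyps] obtain C1 C2 where C: "C1 \<ge> 0" "C2 \<ge> 0"
        and C1: "\<And>w N N'. w \<in> annulus \<delta> L \<Longrightarrow> max (n + 1) (n0 + 1) \<le> N \<Longrightarrow> N \<le> N' \<Longrightarrow>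
          norm (truncated w N' (n + 1) - truncated w N (n + 1)) \<le> C1 * T N"
        and C2: "\<And>w N N'. w \<in> annulus \<delta> L \<Longrightarrow> max (n + 2) (n0 + 1) \<le> N \<Longrightarrow> N \<le> N' \<Longrightarrow>
          norm (truncated w N' (n + 2) - truncated w N (n + 2)) \<le> C2 * T N"
        by metis
      define C where "C = ((\<bar>c (n + 1) - \<tau>\<bar> + L\<^sup>2) * C1 + a (n + 1) * C2) / a n"
      have "norm (truncated w N' n - truncated w N n) \<le> C * T N"
        if w: "w \<in> annulus \<delta> L" and N: "max n (n0 + 1) \<le> N" "N \<le> N'" for w N N'
      proof -
        define s where "s = complex_of_real (c (n + 1) - \<tau>) - w\<^sup>2"
        define d where "d k = truncated w N' k - truncated w N k" for k
        have "n < N" "n < N'"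
          using N False by auto
        then have "d n = (s * d (n + 1) - of_real (a (n + 1)) * d (n + 2)) / of_real (a n)"
          by (simp add: d_def s_def truncated.simps[of w N n] truncated.simps[of w N' n]
              diff_divide_distrib[symmetric] algebra_simps)
        then have "norm (d n) = norm (s * d (n + 1) - of_real (a (n + 1)) * d (n + 2)) / a n"
          using a_pos[of n] by (simp add: norm_divide)
        also have "\<dots> \<le> (norm s * norm (d (n + 1)) + a (n + 1) * norm (d (n + 2))) / a n"
          using norm_triangle_ineq4[of "s * d (n + 1)" "of_real (a (n + 1)) * d (n + 2)"] a_pos[of n] a_pos[of "n + 1"]
          by (intro divide_right_mono) (auto simp: norm_mult)
        also have "\<dots> \<le> ((\<bar>c (n + 1) - \<tau>\<bar> + L\<^sup>2) * (C1 * T N) + a (n + 1) * (C2 * T N)) / a n"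
        proof (intro divide_right_mono add_mono mult_mono)
          have "norm s \<le> norm (complex_of_real (c (n + 1) - \<tau>)) + norm (w\<^sup>2)"
            unfolding s_def by (rule norm_triangle_ineq4)
          also have "\<dots> \<le> \<bar>c (n + 1) - \<tau>\<bar> + L\<^sup>2"
            unfolding norm_of_real norm_power using w by (intro add_left_mono power_mono) (auto simp: annulus_def)
          finally show "norm s \<le> \<bar>c (n + 1) - \<tau>\<bar> + L\<^sup>2" .
          show "norm (d (n + 1)) \<le> C1 * T N" "norm (d (n + 2)) \<le> C2 * T N"
            unfolding d_def using w N False by (auto intro!: C1[simplified] C2[simplified])
        qed (use a_pos[of n] a_pos[of "n + 1"] in auto)
        also have "\<dots> = C * T N"
          using a_pos[of n] by (simp add: C_def field_simps)
        finally show ?thesis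
          by (simp add: d_def)
      qed
      moreover have "C \<ge> 0"
        using C a_pos[of n] a_pos[of "n + 1"] by (simp add: C_def)
      ultimately show ?thesis by blast
    qed
  qed
  then obtain C where C: "C \<ge> 0" "\<And>w N N'. w \<in> annulus \<delta> L \<Longrightarrow> max n (n0 + 1) \<le> N \<Longrightarrow> N \<le> N' \<Longrightarrow>
      norm (truncated w N' n - truncated w N n) \<le> C * T N"
    by blast
  show ?thesis
  proof (rule uniformly_Cauchy_onI')
    fix e :: real assume "e > 0"
    have "(\<lambda>N. C * T N) \<longlonglongrightarrow> C * 0"
      by (intro tendsto_intros T)
    with \<open>e > 0\<close> have "eventually (\<lambda>N. C * T N < e) at_top"
      by (intro order_tendstoD) auto
    then obtain M where M: "\<And>N. N \<ge> M \<Longrightarrow> C * T N < e"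
      by (auto simp: eventually_at_top_linorder)
    have "dist (truncated w N n) (truncated w N' n) < e"
      if "w \<in> annulus \<delta> L" "N \<ge> max M (max n (n0 + 1))" "N' > N" for w N N'
      using C(2)[of w N N'] M[of N] that by (simp add: dist_norm norm_minus_commute)
    then show "\<exists>M. \<forall>w\<in>annulus \<delta> L. \<forall>N\<ge>M. \<forall>N'>N. dist (truncated w N n) (truncated w N' n) < e"
      by blast
  qed
qed

text \<open>
  The solution distinguished by its asymptotics at infinity, as Jost solutions are in scattering theory.
\<close>

definition jost :: "nat \<Rightarrow> complex \<Rightarrow> complex" where
  "jost n w = lim (\<lambda>N. truncated w N n)"

lemma jost_uniform_limit:
  assumes "\<delta> > 0"
  shows "uniform_limit (annulus \<delta> L) (\<lambda>N w. truncated w N n) (jost n) sequentially"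
  using Cauchy_uniformly_convergent[OF truncated_uniformly_Cauchy[OF assms]]
  unfolding uniformly_convergent_uniform_limit_iff jost_def .

lemma truncated_holomorphic: "(\<lambda>w. truncated w N n) holomorphic_on X"
proof (induction "N - n" arbitrary: n rule: less_induct)
  case less
  show ?case
  proof (cases "n \<ge> N")
    case True
    then show ?thesis
      by (simp add: truncated_ge ansatz_def) (intro holomorphic_intros)
  next
    case False
    then have "(\<lambda>w. truncated w N (n + 1)) holomorphic_on X" "(\<lambda>w. truncated w N (n + 2)) holomorphic_on X"
      by (auto intro!: less[simplified])
    moreover have "(\<lambda>w. truncated w N n) =
      (\<lambda>w. ((complex_of_real (c (n + 1) - \<tau>) - w\<^sup>2) * truncated w N (n + 1)
            - complex_of_real (a (n + 1)) * truncated w N (n + 2)) / complex_of_real (a n))"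
      using False by (subst truncated.simps) simp
    ultimately show ?thesis
      using a_pos[of n] by (auto intro!: holomorphic_intros)
  qed
qed

lemma in_annulus:
  assumes "Im w \<ge> 0" "w \<noteq> 0"
  shows "w \<in> annulus (norm w / 2) (2 * norm w)"
  using assms by (simp add: annulus_def)

lemma jost_LIMSEQ:
  assumes "Im w \<ge> 0" "w \<noteq> 0"
  shows "(\<lambda>N. truncated w N n) \<longlonglongrightarrow> jost n w"
  using tendsto_uniform_limitI[OF jost_uniform_limit in_annulus[OF assms]] assms by simp

lemma jost_recurrence:
  assumes w: "Im w \<ge> 0" "w \<noteq> 0" and "n \<ge> 1"
  shows "complex_of_real (a (n - 1)) * jost (n - 1) w + complex_of_real (a n) * jost (n + 1) w
    = (complex_of_real (c n - \<tau>) - w\<^sup>2) * jost n w"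
proof (rule LIMSEQ_unique)
  show "(\<lambda>N. (complex_of_real (c n - \<tau>) - w\<^sup>2) * truncated w N n)
      \<longlonglongrightarrow> (complex_of_real (c n - \<tau>) - w\<^sup>2) * jost n w"
    by (intro tendsto_intros jost_LIMSEQ w)
  have "(\<lambda>N. complex_of_real (a (n - 1)) * truncated w N (n - 1) + complex_of_real (a n) * truncated w N (n + 1))
      \<longlonglongrightarrow> complex_of_real (a (n - 1)) * jost (n - 1) w + complex_of_real (a n) * jost (n + 1) w"
    by (intro tendsto_intros jost_LIMSEQ w)
  then show "(\<lambda>N. (complex_of_real (c n - \<tau>) - w\<^sup>2) * truncated w N n)
      \<longlonglongrightarrow> complex_of_real (a (n - 1)) * jost (n - 1) w + complex_of_real (a n) * jost (n + 1) w"
    by (rule Lim_transform_eventually)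
      (use truncated_recurrence[OF \<open>n \<ge> 1\<close>] in \<open>auto intro!: eventually_at_top_linorderI[of n]\<close>)
qed

lemma jost_asymptotics:
  assumes w: "Im w \<ge> 0" "w \<noteq> 0"
  shows "(\<lambda>n. jost n w / ansatz w n) \<longlonglongrightarrow> 1"
proof -
  obtain T n0 where T: "T \<longlonglongrightarrow> 0" and n0: "n0 \<ge> 1"
    and est: "\<And>n N. n0 \<le> n \<Longrightarrow> n \<le> N \<Longrightarrow> norm (truncated w N n / ansatz w n - 1) \<le> 2 * T n"
    using truncated_estimates[of "norm w / 2" "2 * norm w"] in_annulus[OF w] w(2)
    by (metis half_gt_zero zero_less_norm_iff)
  have "norm (jost n w / ansatz w n - 1) \<le> 2 * T n" if "n \<ge> n0" for n
  proof (rule tendsto_upperbound)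
    show "(\<lambda>N. norm (truncated w N n / ansatz w n - 1)) \<longlonglongrightarrow> norm (jost n w / ansatz w n - 1)"
      using that n0 by (intro tendsto_intros jost_LIMSEQ w ansatz_nonzero) auto
    show "eventually (\<lambda>N. norm (truncated w N n / ansatz w n - 1) \<le> 2 * T n) at_top"
      using est[OF that] by (auto intro: eventually_at_top_linorderI[of n])
  qed auto
  then have "eventually (\<lambda>n. norm (jost n w / ansatz w n - 1) \<le> 2 * T n) at_top"
    by (auto intro: eventually_at_top_linorderI[of n0])
  moreover have "(\<lambda>n. 2 * T n) \<longlonglongrightarrow> 0"
    using tendsto_mult_left[OF T, of 2] by simp
  ultimately have "(\<lambda>n. jost n w / ansatz w n - 1) \<longlonglongrightarrow> 0"
    by (rule Lim_null_comparison)
  then show ?thesis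
    by (simp add: LIM_zero_iff)
qed

text \<open>
  Continuity is local, and near each point the punctured half-plane coincides with a half-annulus, on
  which the convergence of the truncations is uniform.
\<close>

lemma jost_continuous: "continuous_on ({w. Im w \<ge> 0} - {0}) (jost n)"
  unfolding continuous_on_eq_continuous_within
proof
  fix w :: complex assume w: "w \<in> {w. Im w \<ge> 0} - {0}"
  define U where "U = {v :: complex. norm w / 2 < norm v \<and> norm v < 2 * norm w}"
  have "open U"
    unfolding U_def by (intro open_Collect_conj open_Collect_less continuous_intros)
  have "continuous_on (annulus (norm w / 2) (2 * norm w)) (jost n)"
    by (rule uniform_limit_theorem[OF _ jost_uniform_limit])
      (use w in \<open>auto intro!: always_eventually holomorphic_on_imp_continuous_on truncated_holomorphic\<close>)
  then have "continuous (at w within annulus (norm w / 2) (2 * norm w)) (jost n)"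
    using w in_annulus[of w] by (auto simp: continuous_on_eq_continuous_within)
  moreover have "at w within annulus (norm w / 2) (2 * norm w) = at w within ({w. Im w \<ge> 0} - {0})"
    by (rule at_within_nhd[of w U]) (use w \<open>open U\<close> in \<open>auto simp: U_def annulus_def\<close>)
  ultimately show "continuous (at w within ({w. Im w \<ge> 0} - {0})) (jost n)"
    by (simp add: continuous_within)
qed

lemma jost_holomorphic: "jost n holomorphic_on {w. Im w > 0}"
proof (rule holomorphic_uniform_sequence)
  show "open {w. Im w > 0}"
    by (rule open_halfspace_Im_gt)
  show "(\<lambda>w. truncated w N n) holomorphic_on {w. Im w > 0}" for N
    by (rule truncated_holomorphic)
  fix w :: complex assume "w \<in> {w. Im w > 0}"
  then have w: "Im w > 0" by simp
  define d where "d = Im w / 2"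
  have sub: "Im v \<ge> Im w / 2 \<and> norm v \<le> 2 * norm w" if "v \<in> cball w d" for v
  proof -
    have "norm (w - v) \<le> Im w / 2"
      using that by (simp add: d_def dist_norm)
    moreover have "\<bar>Im (w - v)\<bar> \<le> norm (w - v)" "\<bar>Im w\<bar> \<le> norm w"
      by (rule abs_Im_le_cmod)+
    moreover have "norm v \<le> norm w + norm (w - v)"
      by (metis norm_minus_commute norm_triangle_sub)
    ultimately show ?thesis using w by auto
  qed
  have "cball w d \<subseteq> annulus (Im w / 2) (2 * norm w)"
  proof
    fix v assume v: "v \<in> cball w d"
    have "Im v \<le> norm v" using abs_Im_le_cmod[of v] by simp
    with sub[OF v] w show "v \<in> annulus (Im w / 2) (2 * norm w)"
      by (auto simp: annulus_def)
  qed
  then have "uniform_limit (cball w d) (\<lambda>N w. truncated w N n) (jost n) sequentially"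
    using jost_uniform_limit[where \<delta> = "Im w / 2" and L = "2 * norm w"] w by (auto intro: uniform_limit_on_subset)
  moreover have "cball w d \<subseteq> {w. Im w > 0}" "d > 0"
    using sub w by (force simp: d_def)+
  ultimately show "\<exists>d. 0 < d \<and> cball w d \<subseteq> {w. Im w > 0} \<and>
      uniform_limit (cball w d) (\<lambda>N w. truncated w N n) (jost n) sequentially"
    by blast
qed

end

section \<open>The square root up to the edges of the cut\<close>

text \<open>
  The principal root has its cut on the negative axis. Rotating the argument by a quarter turn moves
  this cut to the negative imaginary axis, so that the same formula describes the branch on the
  upper half-plane together with the upper edge.
\<close>

definition upper_root :: "complex \<Rightarrow> complex" where
  "upper_root t = (1 + \<i>) / complex_of_real (sqrt 2) * csqrt (- \<i> * t)"

text \<open>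
  The branch commutes with the reflection $t \mapsto \bar t$ up to the reflection
  $w \mapsto - \bar w$ of the upper half-plane; this transfers everything to the lower edge.
\<close>

definition lower_root :: "complex \<Rightarrow> complex" where
  "lower_root t = - cnj (upper_root (cnj t))"

lemma power2_upper_root: "(upper_root t)\<^sup>2 = t"
proof -
  have "complex_of_real (sqrt 2) * complex_of_real (sqrt 2) = 2"
    by (simp flip: of_real_mult)
  then have "((1 + \<i>) / complex_of_real (sqrt 2))\<^sup>2 = \<i>"
    by (simp add: power2_eq_square algebra_simps)
  then show ?thesis
    unfolding upper_root_def power_mult_distrib by simp
qed

lemma upper_root_quadrant:
  assumes "Im t \<ge> 0"
  shows "Re (upper_root t) \<ge> 0" "Im (upper_root t) \<ge> 0"
proof -
  define s where "s = csqrt (- \<i> * t)"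
  have "s\<^sup>2 = - \<i> * t"
    by (simp add: s_def)
  then have "Re (s\<^sup>2) = Im t"
    by simp
  then have "(Im s)\<^sup>2 \<le> (Re s)\<^sup>2"
    using assms by (simp add: Re_power2)
  moreover have "Re s \<ge> 0"
    unfolding s_def by (rule Re_csqrt)
  ultimately have "\<bar>Im s\<bar> \<le> Re s"
    by (metis abs_le_square_iff abs_of_nonneg)
  moreover have "upper_root t = Complex ((Re s - Im s) / sqrt 2) ((Re s + Im s) / sqrt 2)"
    unfolding upper_root_def s_def[symmetric]
    by (simp add: complex_eq_iff algebra_simps add_divide_distrib diff_divide_distrib)
  ultimately show "Re (upper_root t) \<ge> 0" "Im (upper_root t) \<ge> 0"
    by auto
qed

lemma Im_upper_root_pos:
  assumes "Im t \<ge> 0" "t \<notin> complex_of_real ` {0..}"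
  shows "Im (upper_root t) > 0"
proof (rule ccontr)
  assume "\<not> Im (upper_root t) > 0"
  then have "upper_root t = of_real (Re (upper_root t))"
    using upper_root_quadrant(2)[OF assms(1)] by (simp add: complex_eq_iff)
  then have "t = of_real ((Re (upper_root t))\<^sup>2)"
    by (metis power2_upper_root of_real_power)
  with assms(2) show False
    by (metis atLeast_iff imageI zero_le_power2)
qed

lemma Im_lower_root_pos:
  assumes "Im t \<le> 0" "t \<notin> complex_of_real ` {0..}"
  shows "Im (lower_root t) > 0"
proof -
  have "cnj t \<notin> complex_of_real ` {0..}"
    using assms(2) by (metis (no_types, lifting) complex_cnj_cnj complex_cnj_complex_of_real image_iff)
  then show ?thesis
    using Im_upper_root_pos[of "cnj t"] assms(1) by (simp add: lower_root_def)
qed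

lemma sqrt_cut_Off_eqI:
  assumes "w\<^sup>2 = t" "Im w > 0"
  shows "sqrt_cut (Off t) = w"
  unfolding sqrt_cut.simps
proof (rule the_equality)
  fix v assume "v\<^sup>2 = t \<and> Im v > 0"
  then show "v = w"
    using assms by (auto simp: power2_eq_iff)
qed (use assms in auto)

lemma upper_root_of_real:
  assumes "x \<ge> 0"
  shows "upper_root (complex_of_real x) = complex_of_real (sqrt x)"
proof -
  have "(upper_root (complex_of_real x))\<^sup>2 = (complex_of_real (sqrt x))\<^sup>2"
    using assms by (simp add: power2_upper_root of_real_power[symmetric] del: of_real_power)
  then consider "upper_root (complex_of_real x) = complex_of_real (sqrt x)"
    | "upper_root (complex_of_real x) = - complex_of_real (sqrt x)"
    unfolding power2_eq_iff by blast
  then show ?thesis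
  proof cases
    case 2
    then have "- sqrt x \<ge> 0"
      using upper_root_quadrant(1)[of "complex_of_real x"] by simp
    then have "sqrt x = 0"
      using assms by (simp add: order_antisym)
    with 2 show ?thesis by simp
  qed
qed

lemma sqrt_cut_upper_half:
  assumes "Im t \<ge> 0"
  shows "sqrt_cut (if t \<in> complex_of_real ` {0..} then Upper (Re t) else Off t) = upper_root t"
proof (cases "t \<in> complex_of_real ` {0..}")
  case True
  then show ?thesis
    by (auto simp: upper_root_of_real)
next
  case False
  then show ?thesis
    using sqrt_cut_Off_eqI[OF power2_upper_root Im_upper_root_pos[OF assms False]] by simp
qed

lemma sqrt_cut_lower_half:
  assumes "Im t \<le> 0"
  shows "sqrt_cut (if t \<in> complex_of_real ` {0..} then Lower (Re t) else Off t) = lower_root t"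
proof (cases "t \<in> complex_of_real ` {0..}")
  case True
  then show ?thesis
    by (auto simp: upper_root_of_real lower_root_def)
next
  case False
  then have "Im (lower_root t) > 0"
    using Im_lower_root_pos assms by blast
  moreover have "(lower_root t)\<^sup>2 = t"
    by (simp add: lower_root_def complex_cnj_power[symmetric] power2_upper_root del: complex_cnj_power)
  ultimately show ?thesis
    using sqrt_cut_Off_eqI[of "lower_root t" t] False by simp
qed

lemma continuous_on_upper_root: "continuous_on ({t. Im t \<ge> 0} - {0}) upper_root"
  unfolding upper_root_def
proof (intro continuous_intros continuous_on_compose2[OF continuous_on_csqrt])
  show "(\<lambda>t. - \<i> * t) ` ({t. Im t \<ge> 0} - {0}) \<subseteq> - \<real>\<^sub>\<le>\<^sub>0"
    by (auto simp: complex_nonpos_Reals_iff complex_eq_iff)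
qed

lemma continuous_on_lower_root: "continuous_on ({t. Im t \<le> 0} - {0}) lower_root"
  unfolding lower_root_def
  by (intro continuous_intros continuous_on_compose2[OF continuous_on_upper_root]) auto

text \<open>
  The parameter $w = \sqrt{\gamma z - \tau}$ as a function on the cut plane with its edges.
\<close>

definition spectral_root :: "real \<Rightarrow> real \<Rightarrow> cut_point \<Rightarrow> complex" where
  "spectral_root \<gamma> \<tau> z = sqrt_cut (shift_point \<tau> (scale_point \<gamma> z))"

lemma phi_eq_spectral_root: "phi \<tau> n (scale_point \<gamma> z)
    = spectral_root \<gamma> \<tau> z * complex_of_real (\<Sum>m = 1..n. real m powr (- (1 / 2)))"
  by (simp add: phi_def theta_def spectral_root_def sum_distrib_left)

lemma cut_plane_iff:
  assumes "\<gamma> \<in> {1, - 1}"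
  shows "z \<in> cut_plane \<gamma> \<tau> \<longleftrightarrow> complex_of_real \<gamma> * z - complex_of_real \<tau> \<notin> complex_of_real ` {0..}"
proof -
  have "z \<in> complex_of_real ` cut \<gamma> \<tau>
      \<longleftrightarrow> complex_of_real \<gamma> * z - complex_of_real \<tau> \<in> complex_of_real ` {0..}"
  proof
    assume "z \<in> complex_of_real ` cut \<gamma> \<tau>"
    then obtain x where "x \<ge> \<tau>" "z = complex_of_real (\<gamma> * x)"
      by (auto simp: cut_def)
    then have "complex_of_real \<gamma> * z - complex_of_real \<tau> = complex_of_real (x - \<tau>)" "x - \<tau> \<ge> 0"
      using assms by auto
    then show "complex_of_real \<gamma> * z - complex_of_real \<tau> \<in> complex_of_real ` {0..}"
      by (metis atLeast_iff imageI)
  next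
    assume "complex_of_real \<gamma> * z - complex_of_real \<tau> \<in> complex_of_real ` {0..}"
    then obtain x where x: "x \<ge> 0" "complex_of_real \<gamma> * z - complex_of_real \<tau> = complex_of_real x"
      by auto
    then have "complex_of_real \<gamma> * z = complex_of_real (x + \<tau>)"
      by (simp add: algebra_simps)
    moreover have "z = complex_of_real \<gamma> * (complex_of_real \<gamma> * z)"
      using assms by auto
    ultimately have "z = complex_of_real (\<gamma> * (x + \<tau>))"
      by (metis of_real_mult)
    moreover have "x + \<tau> \<ge> \<tau>"
      using x by simp
    ultimately show "z \<in> complex_of_real ` cut \<gamma> \<tau>"
      unfolding cut_def by (metis atLeast_iff imageI)
  qed
  then show ?thesis
    by (simp add: cut_plane_def)
qed

lemma open_cut_plane:
  assumes "\<gamma> \<in> {1, - 1}"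
  shows "open (cut_plane \<gamma> \<tau>)"
proof -
  have "cut_plane \<gamma> \<tau> = - {z. Im (complex_of_real \<gamma> * z - complex_of_real \<tau>) = 0
      \<and> Re (complex_of_real \<gamma> * z - complex_of_real \<tau>) \<ge> 0}"
    unfolding set_eq_iff cut_plane_iff[OF assms]
    by (auto simp: image_iff complex_eq_iff intro!: bexI[of _ "Re (complex_of_real \<gamma> * _ - complex_of_real \<tau>)"])
  also have "open \<dots>"
    by (intro open_Compl closed_Collect_conj closed_Collect_eq closed_Collect_le continuous_intros)
  finally show ?thesis .
qed

text \<open>
  For $\gamma = -1$ the map $z \mapsto \gamma z - \tau$ exchanges the half-planes, and with them the
  two edges.
\<close>

lemma spectral_root_from_above:
  assumes "\<gamma> \<in> {1, - 1}" "Im z \<ge> 0"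
  shows "spectral_root \<gamma> \<tau> (from_above \<gamma> \<tau> z)
    = (if \<gamma> = 1 then upper_root else lower_root) (complex_of_real \<gamma> * z - complex_of_real \<tau>)"
  using assms(1)
proof (elim insertE emptyE)
  assume "\<gamma> = 1"
  then show ?thesis
    using sqrt_cut_upper_half[of "z - complex_of_real \<tau>"] assms(2) cut_plane_iff[OF assms(1), of z \<tau>]
    by (cases "z - complex_of_real \<tau> \<in> complex_of_real ` {0..}")
      (simp_all add: spectral_root_def from_above_def)
next
  assume "\<gamma> = - 1"
  then show ?thesis
    using sqrt_cut_lower_half[of "- z - complex_of_real \<tau>"] assms(2) cut_plane_iff[OF assms(1), of z \<tau>]
    by (cases "- z - complex_of_real \<tau> \<in> complex_of_real ` {0..}")
      (simp_all add: spectral_root_def from_above_def)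
qed

lemma spectral_root_from_below:
  assumes "\<gamma> \<in> {1, - 1}" "Im z \<le> 0"
  shows "spectral_root \<gamma> \<tau> (from_below \<gamma> \<tau> z)
    = (if \<gamma> = 1 then lower_root else upper_root) (complex_of_real \<gamma> * z - complex_of_real \<tau>)"
  using assms(1)
proof (elim insertE emptyE)
  assume "\<gamma> = 1"
  then show ?thesis
    using sqrt_cut_lower_half[of "z - complex_of_real \<tau>"] assms(2) cut_plane_iff[OF assms(1), of z \<tau>]
    by (cases "z - complex_of_real \<tau> \<in> complex_of_real ` {0..}")
      (simp_all add: spectral_root_def from_below_def)
next
  assume "\<gamma> = - 1"
  then show ?thesis
    using sqrt_cut_upper_half[of "- z - complex_of_real \<tau>"] assms(2) cut_plane_iff[OF assms(1), of z \<tau>]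
    by (cases "- z - complex_of_real \<tau> \<in> complex_of_real ` {0..}")
      (simp_all add: spectral_root_def from_below_def)
qed

lemma spectral_root_Off:
  assumes "\<gamma> \<in> {1, - 1}" "z \<in> cut_plane \<gamma> \<tau>"
  shows "spectral_root \<gamma> \<tau> (Off z) = \<i> * csqrt (- (complex_of_real \<gamma> * z - complex_of_real \<tau>))"
    and "Im (spectral_root \<gamma> \<tau> (Off z)) > 0"
proof -
  define t where "t = complex_of_real \<gamma> * z - complex_of_real \<tau>"
  have t: "t \<notin> complex_of_real ` {0..}"
    using assms cut_plane_iff by (simp add: t_def)
  show "spectral_root \<gamma> \<tau> (Off z) = \<i> * csqrt (- (complex_of_real \<gamma> * z - complex_of_real \<tau>))"
    using sqrt_cut_Off[OF t] by (simp add: spectral_root_def t_def)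
  have "Im (sqrt_cut (Off t)) > 0"
    using sqrt_cut_upper_half[of t] sqrt_cut_lower_half[of t] t
      Im_upper_root_pos[OF _ t] Im_lower_root_pos[OF _ t]
    by (cases "Im t \<ge> 0") (simp_all del: sqrt_cut.simps)
  then show "Im (spectral_root \<gamma> \<tau> (Off z)) > 0"
    by (simp add: spectral_root_def t_def del: sqrt_cut.simps)
qed

lemma holomorphic_on_spectral_root:
  assumes "\<gamma> \<in> {1, - 1}"
  shows "(\<lambda>z. spectral_root \<gamma> \<tau> (Off z)) holomorphic_on cut_plane \<gamma> \<tau>"
proof -
  have "(\<lambda>z. \<i> * csqrt (- (complex_of_real \<gamma> * z - complex_of_real \<tau>))) holomorphic_on cut_plane \<gamma> \<tau>"
  proof (intro holomorphic_intros)
    fix z assume "z \<in> cut_plane \<gamma> \<tau>"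
    then have "complex_of_real \<gamma> * z - complex_of_real \<tau> \<notin> complex_of_real ` {0..}"
      using assms cut_plane_iff by simp
    then show "- (complex_of_real \<gamma> * z - complex_of_real \<tau>) \<notin> \<real>\<^sub>\<le>\<^sub>0"
      by (fastforce simp: complex_nonpos_Reals_iff image_iff complex_eq_iff)
  qed
  then show ?thesis
    by (rule holomorphic_transform) (simp add: spectral_root_Off[OF assms])
qed

lemma spectral_root_closed_cut_plane:
  assumes "\<gamma> \<in> {1, - 1}" "z \<in> closed_cut_plane \<gamma> \<tau>"
  shows "(spectral_root \<gamma> \<tau> z)\<^sup>2 = complex_of_real \<gamma> * point_value z - complex_of_real \<tau>"
    and "Im (spectral_root \<gamma> \<tau> z) \<ge> 0" and "spectral_root \<gamma> \<tau> z \<noteq> 0"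
proof -
  have "(spectral_root \<gamma> \<tau> z)\<^sup>2 = complex_of_real \<gamma> * point_value z - complex_of_real \<tau>
    \<and> Im (spectral_root \<gamma> \<tau> z) \<ge> 0 \<and> spectral_root \<gamma> \<tau> z \<noteq> 0"
  proof (cases z)
    case (Off v)
    then have v: "v \<in> cut_plane \<gamma> \<tau>"
      using assms(2) by (auto simp: closed_cut_plane_def)
    have "(spectral_root \<gamma> \<tau> (Off v))\<^sup>2 = complex_of_real \<gamma> * v - complex_of_real \<tau>"
      unfolding spectral_root_Off(1)[OF assms(1) v] by (simp add: power_mult_distrib)
    with spectral_root_Off(2)[OF assms(1) v] Off show ?thesis
      by auto
  next
    case (Upper x)
    then have "\<gamma> * x > \<tau>"
      using assms by (auto simp: closed_cut_plane_def cut_def)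
    then show ?thesis
      using assms(1) Upper
      by (auto simp: spectral_root_def of_real_power[symmetric] simp del: of_real_power)
  next
    case (Lower x)
    then have "\<gamma> * x > \<tau>"
      using assms by (auto simp: closed_cut_plane_def cut_def)
    then show ?thesis
      using assms(1) Lower
      by (auto simp: spectral_root_def of_real_power[symmetric] simp del: of_real_power)
  qed
  then show "(spectral_root \<gamma> \<tau> z)\<^sup>2 = complex_of_real \<gamma> * point_value z - complex_of_real \<tau>"
    and "Im (spectral_root \<gamma> \<tau> z) \<ge> 0" and "spectral_root \<gamma> \<tau> z \<noteq> 0"
    by blast+
qed

lemma continuous_up_to_cut_spectral_root:
  assumes \<gamma>: "\<gamma> \<in> {1, - 1}" and g: "continuous_on ({w. Im w \<ge> 0} - {0}) g"
  shows "continuous_up_to_cut \<gamma> \<tau> (\<lambda>z. g (spectral_root \<gamma> \<tau> z))"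
proof -
  have upper: "continuous_on ({t. Im t \<ge> 0} - {0}) (\<lambda>t. g (upper_root t))"
  proof (rule continuous_on_compose2[OF g continuous_on_upper_root])
    have "Im (upper_root t) \<ge> 0 \<and> upper_root t \<noteq> 0" if "Im t \<ge> 0" "t \<noteq> 0" for t
      using that upper_root_quadrant(2)[of t] power2_upper_root[of t] by auto
    then show "upper_root ` ({t. Im t \<ge> 0} - {0}) \<subseteq> {w. Im w \<ge> 0} - {0}"
      by auto
  qed
  have lower: "continuous_on ({t. Im t \<le> 0} - {0}) (\<lambda>t. g (lower_root t))"
  proof (rule continuous_on_compose2[OF g continuous_on_lower_root])
    have "Im (lower_root t) \<ge> 0 \<and> lower_root t \<noteq> 0" if "Im t \<le> 0" "t \<noteq> 0" for t
      using that upper_root_quadrant(2)[of "cnj t"] power2_upper_root[of "cnj t"]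
      by (auto simp: lower_root_def)
    then show "lower_root ` ({t. Im t \<le> 0} - {0}) \<subseteq> {w. Im w \<ge> 0} - {0}"
      by auto
  qed
  have nz: "complex_of_real \<gamma> * z - complex_of_real \<tau> \<noteq> 0" if "z \<noteq> complex_of_real (\<gamma> * \<tau>)" for z
  proof
    assume "complex_of_real \<gamma> * z - complex_of_real \<tau> = 0"
    then have "complex_of_real \<gamma> * (complex_of_real \<gamma> * z) = complex_of_real (\<gamma> * \<tau>)"
      by simp
    moreover have "complex_of_real \<gamma> * (complex_of_real \<gamma> * z) = z"
      using \<gamma> by auto
    ultimately show False
      using that by simp
  qed
  have "continuous_on ({z. Im z \<ge> 0} - {complex_of_real (\<gamma> * \<tau>)})
      (\<lambda>z. g ((if \<gamma> = 1 then upper_root else lower_root) (complex_of_real \<gamma> * z - complex_of_real \<tau>)))"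
    using \<gamma> nz by (auto intro!: continuous_on_compose2[OF upper] continuous_on_compose2[OF lower] continuous_intros)
  moreover have "continuous_on ({z. Im z \<le> 0} - {complex_of_real (\<gamma> * \<tau>)})
      (\<lambda>z. g ((if \<gamma> = 1 then lower_root else upper_root) (complex_of_real \<gamma> * z - complex_of_real \<tau>)))"
    using \<gamma> nz by (auto intro!: continuous_on_compose2[OF upper] continuous_on_compose2[OF lower] continuous_intros)
  ultimately show ?thesis
    unfolding continuous_up_to_cut_def
    by (subst (1 2) continuous_on_cong[OF refl])
      (auto simp: spectral_root_from_above[OF \<gamma>] spectral_root_from_below[OF \<gamma>])
qed

theorem theorem2p4:
  fixes \<gamma> \<alpha> \<beta> \<tau> \<rho> :: real and a b :: "nat \<Rightarrow> real"
  assumes "\<gamma> \<in> {1, - 1}"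
    and "\<And>n. a n > 0"
    and "(\<lambda>n. a n / real n - (1 + \<alpha> / real n)) \<in> O(\<lambda>n. 1 / (real n)\<^sup>2)"
    and "(\<lambda>n. b n / (2 * \<gamma> * real n) - (1 + \<beta> / real n)) \<in> O(\<lambda>n. 1 / (real n)\<^sup>2)"
    and "\<tau> = 2 * \<beta> - 2 * \<alpha> + 1"
    and "\<rho> = 1 / 4"
  shows "\<exists>f :: nat \<Rightarrow> cut_point \<Rightarrow> complex.
    (\<forall>z \<in> closed_cut_plane \<gamma> \<tau>.
       (\<forall>n\<ge>1. complex_of_real (a (n - 1)) * f (n - 1) z + complex_of_real (b n) * f n z
                + complex_of_real (a n) * f (n + 1) z = point_value z * f n z) \<and>
       (\<lambda>n. f n z) \<sim>[sequentially]
         (\<lambda>n. complex_of_real ((- \<gamma>) ^ n * real n powr (- \<rho>))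
                * exp (\<i> * phi \<tau> n (scale_point \<gamma> z)))) \<and>
    (\<forall>n. (\<lambda>z. f n (Off z)) analytic_on cut_plane \<gamma> \<tau> \<and>
         continuous_up_to_cut \<gamma> \<tau> (f n))"
proof -
  note \<gamma> = assms(1)
  have \<gamma>2: "\<gamma> * \<gamma> = 1" and \<gamma>0: "\<gamma> \<noteq> 0"
    using \<gamma> by auto
  have scale: "(\<lambda>n. real n * x n) \<in> O(\<lambda>n. 1 / real n)" if "x \<in> O(\<lambda>n. 1 / (real n)\<^sup>2)" for x :: "nat \<Rightarrow> real"
  proof -
    have "(\<lambda>n. real n * x n) \<in> O(\<lambda>n. real n * (1 / (real n)\<^sup>2))"
      by (intro landau_o.big.mult_left that)
    then show ?thesis
      by (simp add: power2_eq_square)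
  qed
  have c_scaled: "(\<lambda>n. 2 * (real n * (b n / (2 * \<gamma> * real n) - (1 + \<beta> / real n)))) \<in> O(\<lambda>n. 1 / real n)"
    using scale[OF assms(4)] by (subst landau_o.big.cmult_in_iff) auto
  interpret discrete_bessel a "\<lambda>n. \<gamma> * b n" \<alpha> \<beta> \<tau>
  proof
    show "a n > 0" for n
      by (rule assms(2))
    show "\<tau> = 2 * \<beta> - 2 * \<alpha> + 1"
      by (rule assms(5))
    show "(\<lambda>n. a n - (real n + \<alpha>)) \<in> O(\<lambda>n. 1 / real n)"
      using scale[OF assms(3)]
      by (rule iffD1[OF landau_o.big.in_cong, rotated])
        (rule eventually_mono[OF eventually_gt_at_top[of 0]], simp add: field_simps)
    show "(\<lambda>n. \<gamma> * b n - (2 * real n + 2 * \<beta>)) \<in> O(\<lambda>n. 1 / real n)"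
      using c_scaled
      by (rule iffD1[OF landau_o.big.in_cong, rotated])
        (rule eventually_mono[OF eventually_gt_at_top[of 0]], use \<gamma> in \<open>auto simp: field_simps\<close>)
  qed
  define f where "f n z = complex_of_real ((- \<gamma>) ^ n) * jost n (spectral_root \<gamma> \<tau> z)" for n z
  have recurrence: "complex_of_real (a (n - 1)) * f (n - 1) z + complex_of_real (b n) * f n z
      + complex_of_real (a n) * f (n + 1) z = point_value z * f n z"
    if z: "z \<in> closed_cut_plane \<gamma> \<tau>" and n: "n \<ge> 1" for z n
  proof -
    define w where "w = spectral_root \<gamma> \<tau> z"
    define s g where "s = complex_of_real ((- \<gamma>) ^ (n - 1))" and "g = complex_of_real \<gamma>"
    have gg: "g * g = 1"
      unfolding g_def of_real_mult[symmetric] \<gamma>2 by simp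
    have n_eq: "n = Suc (n - 1)"
      using n by simp
    have powers: "complex_of_real ((- \<gamma>) ^ n) = - g * s" "complex_of_real ((- \<gamma>) ^ (n + 1)) = g * g * s"
      by (subst n_eq, simp add: s_def g_def)+
    have "w\<^sup>2 = g * point_value z - of_real \<tau>"
      using spectral_root_closed_cut_plane(1)[OF \<gamma> z] by (simp add: w_def g_def)
    moreover have "of_real (a (n - 1)) * jost (n - 1) w + of_real (a n) * jost (n + 1) w
        = (g * of_real (b n) - of_real \<tau> - w\<^sup>2) * jost n w"
      using jost_recurrence[of w n] spectral_root_closed_cut_plane[OF \<gamma> z] n by (simp add: w_def g_def)
    ultimately show ?thesis
      using gg unfolding f_def w_def[symmetric] powers s_def[symmetric] by algebra
  qed
  have asymptotics: "(\<lambda>n. f n z) \<sim>[sequentially]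
         (\<lambda>n. complex_of_real ((- \<gamma>) ^ n * real n powr (- \<rho>)) * exp (\<i> * phi \<tau> n (scale_point \<gamma> z)))"
    if z: "z \<in> closed_cut_plane \<gamma> \<tau>" for z
  proof (rule asymp_equivI')
    define w where "w = spectral_root \<gamma> \<tau> z"
    have "f n z / (complex_of_real ((- \<gamma>) ^ n * real n powr (- \<rho>)) * exp (\<i> * phi \<tau> n (scale_point \<gamma> z)))
        = jost n w / ansatz w n" for n
      using \<gamma>0 by (simp add: f_def phi_eq_spectral_root w_def ansatz_def phase_def assms(6) mult.assoc)
    then show "(\<lambda>n. f n z / (complex_of_real ((- \<gamma>) ^ n * real n powr (- \<rho>))
        * exp (\<i> * phi \<tau> n (scale_point \<gamma> z)))) \<longlonglongrightarrow> 1"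
      using jost_asymptotics[of w] spectral_root_closed_cut_plane[OF \<gamma> z] by (simp add: w_def)
  qed
  have analytic: "(\<lambda>z. f n (Off z)) analytic_on cut_plane \<gamma> \<tau>" for n
  proof -
    have "(\<lambda>z. jost n (spectral_root \<gamma> \<tau> (Off z))) holomorphic_on cut_plane \<gamma> \<tau>"
      by (rule holomorphic_on_compose_gen[OF holomorphic_on_spectral_root[OF \<gamma>] jost_holomorphic, unfolded o_def])
        (use spectral_root_Off(2)[OF \<gamma>] in auto)
    then have "(\<lambda>z. f n (Off z)) holomorphic_on cut_plane \<gamma> \<tau>"
      unfolding f_def by (intro holomorphic_intros)
    then show ?thesis
      by (simp add: analytic_on_open open_cut_plane[OF \<gamma>])
  qed
  have "continuous_up_to_cut \<gamma> \<tau> (f n)" for n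
    unfolding f_def
    by (intro continuous_up_to_cut_spectral_root[OF \<gamma>] continuous_intros jost_continuous)
  with recurrence asymptotics analytic show ?thesis
    by blast
qed

end
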